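(* Let $R$ be a finite non-local commutative ring with non-zero identity. If $R$ is not isomorphic to $\mathbb{Z}_2\oplus F$ for any field $F$, then the Jacobson graph $\mathfrak{J}_R$ is pancyclic.
   Context: All rings are commutative with a non-zero identity. For a ring $R$, $J(R)$ denotes its Jacobson radical and $U(R)$ its group of units. The Jacobson graph $\mathfrak{J}_R$ of $R$ is the simple graph with vertex set $R\setminus J(R)$ in which two distinct vertices $x,y$ are adjacent if and only if $1-xy\notin U(R)$. $\mathbb{Z}_m$ denotes the ring $\mathbb{Z}/m\mathbb{Z}$ and $\oplus$ is the direct sum (product) of rings. A graph $G$ is pancyclic if it contains cycles of length $l$ for each $3\leq l\leq|V(G)|$. *)

theory Defs
  imports "HOL-Algebra.Algebra" "Graph_Theory.Graph_Theory"
begin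

definition local_ring :: "('a, 'm) ring_scheme \<Rightarrow> bool" where
  "local_ring R \<longleftrightarrow> (\<exists>!M. maximalideal M R)"

definition jacobson_radical :: "('a, 'm) ring_scheme \<Rightarrow> 'a set" where
  "jacobson_radical R = {x \<in> carrier R. \<forall>M. maximalideal M R \<longrightarrow> x \<in> M}"

text \<open>As usual in the theory of digraphs used here, an undirected edge is the pair of
  opposite arcs between its two end points.\<close>

definition jacobson_graph :: "('a, 'm) ring_scheme \<Rightarrow> 'a pair_pre_digraph" where
  "jacobson_graph R =
     \<lparr> pverts = carrier R - jacobson_radical R,
       parcs = {(x, y). x \<in> carrier R - jacobson_radical R \<and> y \<in> carrier R - jacobson_radical R \<and>
                  x \<noteq> y \<and> \<one>\<^bsub>R\<^esub> \<ominus>\<^bsub>R\<^esub> x \<otimes>\<^bsub>R\<^esub> y \<notin> Units R} \<rparr>"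

text \<open>The library predicate \<^const>\<open>pre_digraph.cycle\<close> also accepts closed walks of length 1
  (loops) and 2 (an edge traversed back and forth). From length 3 on, in a symmetric digraph
  without loops and parallel arcs, it describes exactly the cycles of the undirected graph.\<close>

definition pancyclic :: "('a, 'b) pre_digraph \<Rightarrow> bool" where
  "pancyclic G \<longleftrightarrow>
     (\<forall>l. 3 \<le> l \<and> l \<le> card (verts G) \<longrightarrow> (\<exists>p. pre_digraph.cycle G p \<and> length p = l))"

lemma pair_graph_jacobson_graph:
  assumes "cring R" and "finite (carrier R)"
  shows "pair_graph (jacobson_graph R)"
proof -
  interpret cring R by fact
  let ?V = "carrier R - jacobson_radical R"
  have "parcs (jacobson_graph R) \<subseteq> ?V \<times> ?V"
    by (auto simp: jacobson_graph_def)
  moreover have "finite (?V \<times> ?V)" using assms(2) by simp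
  ultimately have "finite (parcs (jacobson_graph R))" by (rule finite_subset)
  then show ?thesis
    using assms(2)
    by unfold_locales
      (auto simp: jacobson_graph_def symmetric_def sym_def m_comm)
qed

text \<open>A field \<open>F\<close> with \<open>R \<simeq> \<int>/2\<int> \<times> F\<close> has a copy carried by elements of \<open>R\<close>. Hence it makes
  no difference to require the non-existence of \<open>F\<close> only over the element type of \<open>R\<close>.\<close>

lemma Z2_times_field_element_type:
  fixes R :: "('a, 'm) ring_scheme" and F :: "'b ring"
  assumes R: "ring R" and F: "field F" and iso: "R \<simeq> RDirProd (ZFact 2) F"
  shows "\<exists>F' :: 'a ring. field F' \<and> R \<simeq> RDirProd (ZFact 2) F'"
proof -
  interpret Z: cring "ZFact 2" by (rule ZFact_is_cring)
  interpret F: field F by fact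
  have "RDirProd (ZFact 2) F \<simeq> R"
    using ring_iso_sym[OF R iso] .
  then obtain h where h: "h \<in> ring_iso (RDirProd (ZFact 2) F) R"
    unfolding is_ring_iso_def by auto
  define g where "g y = h (\<zero>\<^bsub>ZFact 2\<^esub>, y)" for y
  have "inj_on h (carrier (ZFact 2) \<times> carrier F)"
    using h unfolding ring_iso_def bij_betw_def by (auto simp: RDirProd_carrier)
  then have inj: "inj_on g (carrier F)"
    unfolding g_def inj_on_def by auto
  have fld: "field (image_ring g F)"
    using F.inj_imp_image_ring_is_field[OF inj] .
  have g: "g \<in> ring_iso F (image_ring g F)"
    using inj_imp_image_ring_iso[OF inj] .
  have "RDirProd (ZFact 2) F \<simeq> RDirProd (ZFact 2) (image_ring g F)"
    using RDirProd_iso5[OF g] unfolding is_ring_iso_def by blast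
  then have iso': "R \<simeq> RDirProd (ZFact 2) (image_ring g F)"
    using iso ring_iso_trans by blast
  show ?thesis using fld iso' by blast
qed

end

theory Submission
  imports Defs
begin

text \<open>Two elements are joined iff \<open>1 - x y\<close> lies in some maximal ideal. Fix a maximal ideal \<open>M\<close> with
  residue field \<open>K\<close> and write ring elements as pairs \<open>(y, m) \<in> K \<times> M\<close>. The rows \<open>y\<close> and \<open>1/y\<close> are
  completely joined, and \<open>(y, m)\<close> and \<open>(z, n)\<close> are joined whenever \<open>1 - m n\<close> lies in another maximal
  ideal. In particular all \<open>(y, g)\<close> are joined to each other, where \<open>g\<close> is \<open>0\<close> modulo \<open>M\<close> and \<open>1\<close> modulo
  the other maximal ideals, and the vertex \<open>(0, m')\<close> of row \<open>0\<close> is joined to all \<open>(y, m)\<close> if \<open>m'\<close> is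
  inverse to \<open>m\<close> at some maximal ideal outside of \<open>M\<close>. The excluded rings are those with
  \<open>M - J = {g}\<close>; a second element \<open>d\<close> of \<open>M - J\<close> lets a cycle enter and leave the clique row \<open>1\<close> at
  different vertices.

  If some residue field has more than three elements, take it as \<open>K\<close>: row \<open>0\<close> is inserted into the edges
  \<open>(y, m), (1/y, m)\<close> of a single pair of rows with \<open>y \<noteq> 1/y\<close>, and the other rows are appended through
  \<open>(y, g)\<close>. If all residue fields have two or three elements and one has three, take that one as \<open>K\<close>: the
  cycle zigzags between the cliques \<open>1\<close> and \<open>-1\<close> through row \<open>0\<close>. If all residue fields have two
  elements, row \<open>0\<close> has a Hamiltonian path, which is closed up through the clique row \<open>1\<close>.\<close>

no_notation vwalk_join (infixr \<open>\<oplus>\<close> 65)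

section \<open>Paths and cycles of prescribed length\<close>

text \<open>Lengths count vertices rather than edges, so they add up under concatenation and are
  bounded by the size of the vertex set.\<close>

definition path_between :: "('v \<Rightarrow> 'v \<Rightarrow> bool) \<Rightarrow> 'v set \<Rightarrow> 'v \<Rightarrow> 'v \<Rightarrow> nat \<Rightarrow> bool" where
  "path_between A S u v l \<longleftrightarrow>
     (\<exists>p. p \<noteq> [] \<and> distinct p \<and> successively A p \<and> hd p = u \<and> last p = v \<and> set p \<subseteq> S \<and> length p = l)"

definition cycle_in :: "('v \<Rightarrow> 'v \<Rightarrow> bool) \<Rightarrow> 'v set \<Rightarrow> nat \<Rightarrow> bool" where
  "cycle_in A S l \<longleftrightarrow>
     (\<exists>p. p \<noteq> [] \<and> distinct p \<and> successively A p \<and> A (last p) (hd p) \<and> set p \<subseteq> S \<and> length p = l)"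

lemma path_betweenI:
  "p \<noteq> [] \<Longrightarrow> distinct p \<Longrightarrow> successively A p \<Longrightarrow> hd p = u \<Longrightarrow> last p = v \<Longrightarrow> set p \<subseteq> S \<Longrightarrow>
   length p = l \<Longrightarrow> path_between A S u v l"
  unfolding path_between_def by blast

lemma path_between_append:
  assumes "path_between A S u v l" "path_between A T x y k" "S \<inter> T = {}" "A v x"
  shows "path_between A (S \<union> T) u y (l + k)"
proof -
  obtain p where p: "p \<noteq> []" "distinct p" "successively A p" "hd p = u" "last p = v"
      "set p \<subseteq> S" "length p = l"
    using assms(1) unfolding path_between_def by blast
  obtain q where q: "q \<noteq> []" "distinct q" "successively A q" "hd q = x" "last q = y"
      "set q \<subseteq> T" "length q = k"
    using assms(2) unfolding path_between_def by blast
  show ?thesis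
    by (rule path_betweenI[of "p @ q"]) (use p q assms(3,4) in \<open>auto simp: successively_append_iff\<close>)
qed

lemma path_between_mono: "path_between A S u v l \<Longrightarrow> S \<subseteq> T \<Longrightarrow> path_between A T u v l"
  unfolding path_between_def by blast

lemma path_between_singleton: "path_between A {u} u u 1"
  by (rule path_betweenI[of "[u]"]) auto

lemma path_between_le_card:
  assumes "path_between A S u v l" "finite S"
  shows "l \<le> card S"
proof -
  obtain p where p: "distinct p" "set p \<subseteq> S" "length p = l"
    using assms(1) unfolding path_between_def by blast
  then show ?thesis
    using card_mono[OF assms(2) p(2)] distinct_card[OF p(1)] by simp
qed

lemma cycle_in_close: "path_between A S u v l \<Longrightarrow> A v u \<Longrightarrow> cycle_in A S l"
  unfolding cycle_in_def path_between_def by blast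

lemma cycle_in_mono: "cycle_in A S l \<Longrightarrow> S \<subseteq> T \<Longrightarrow> cycle_in A T l"
  unfolding cycle_in_def by blast

lemma clique_successively:
  assumes "\<And>x y. x \<in> set p \<Longrightarrow> y \<in> set p \<Longrightarrow> x \<noteq> y \<Longrightarrow> A x y" "distinct p"
  shows "successively A p"
  using assms by (induction A p rule: successively.induct) auto

lemma path_between_clique:
  assumes "finite K" "\<And>x y. x \<in> K \<Longrightarrow> y \<in> K \<Longrightarrow> x \<noteq> y \<Longrightarrow> A x y"
    and "u \<in> K" "v \<in> K" "u \<noteq> v" "2 \<le> l" "l \<le> card K"
  shows "path_between A K u v l"
proof -
  have "l - 2 \<le> card (K - {u, v})"
    using assms by (simp add: card_Diff_subset)
  then obtain T where T: "T \<subseteq> K - {u, v}" "card T = l - 2" "finite T"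
    using assms(1) by (meson finite_Diff obtain_subset_with_card_n)
  obtain xs where xs: "set xs = T" "distinct xs"
    using finite_distinct_list[OF T(3)] by blast
  then have "length xs = l - 2"
    using T distinct_card by fastforce
  have d: "distinct (u # xs @ [v])" using xs T assms(5) by auto
  have "successively A (u # xs @ [v])"
    by (rule clique_successively) (use d xs T assms in auto)
  then show ?thesis
    by (intro path_betweenI[of "u # xs @ [v]"])
      (use d xs T assms \<open>length xs = l - 2\<close> in auto)
qed

section \<open>Extending families of cycles by blocks\<close>

text \<open>Extending a \<open>good\<close> set by a \<open>gapped\<close> block keeps all cycle lengths: if the block has no path
  of length \<open>l\<close>, one of length \<open>l + 1\<close> is combined with the path that leaves out one vertex of the
  good set. This absorbs the parity constraint of complete bipartite blocks.\<close>

definition good :: "('v \<Rightarrow> 'v \<Rightarrow> bool) \<Rightarrow> 'v \<Rightarrow> 'v set \<Rightarrow> 'v \<Rightarrow> bool" where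
  "good A u S v \<longleftrightarrow> finite S \<and> path_between A S u v (card S) \<and> path_between A S u v (card S - 1) \<and>
     (\<forall>l. 3 \<le> l \<and> l \<le> card S \<longrightarrow> cycle_in A S l)"

definition gapped :: "('v \<Rightarrow> 'v \<Rightarrow> bool) \<Rightarrow> 'v set \<Rightarrow> 'v \<Rightarrow> 'v \<Rightarrow> bool" where
  "gapped A B a b \<longleftrightarrow> finite B \<and> B \<noteq> {} \<and>
     (\<forall>l. 1 \<le> l \<and> l \<le> card B \<longrightarrow> path_between A B a b l \<or> path_between A B a b (Suc l))"

text \<open>At the top length the second alternative would need more vertices than the block
  has.\<close>

lemma gapped_full: "gapped A B a b \<Longrightarrow> path_between A B a b (card B)"
  unfolding gapped_def
  by (metis One_nat_def Suc_leI card_gt_0_iff not_less_eq_eq order_refl path_between_le_card)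

lemma good_extend:
  assumes "good A u S v" "gapped A B a b" "S \<inter> B = {}" "A v a" "A b u"
  shows "good A u (S \<union> B) b"
proof -
  have fin: "finite S" "finite B" using assms unfolding good_def gapped_def by auto
  then have c: "card (S \<union> B) = card S + card B" using assms(3) card_Un_disjoint by blast
  have pos: "1 \<le> card S" "1 \<le> card B"
    using assms fin unfolding good_def gapped_def path_between_def
    by (auto simp: Suc_le_eq card_gt_0_iff)
  have p0: "path_between A S u v (card S)" and p1: "path_between A S u v (card S - 1)"
    using assms(1) unfolding good_def by auto
  have full: "path_between A B a b (card B)" by (rule gapped_full[OF assms(2)])
  have "cycle_in A (S \<union> B) l" if l: "3 \<le> l" "l \<le> card S + card B" for l
  proof (cases "l \<le> card S")
    case True
    then show ?thesis using assms(1) l cycle_in_mono unfolding good_def by blast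
  next
    case False
    define k where "k = l - card S"
    have k: "1 \<le> k" "k \<le> card B" "l = card S + k" using False l k_def by auto
    then consider "path_between A B a b k" | "path_between A B a b (Suc k)"
      using assms(2) unfolding gapped_def by blast
    then show ?thesis
    proof cases
      case 1
      then show ?thesis
        using path_between_append[OF p0 1 assms(3,4)] assms(5) k cycle_in_close by metis
    next
      case 2
      have "card S - 1 + Suc k = l" using k pos by simp
      then show ?thesis
        using path_between_append[OF p1 2 assms(3,4)] assms(5) cycle_in_close by metis
    qed
  qed
  moreover have "path_between A (S \<union> B) u b (card S + card B)"
    using path_between_append[OF p0 full assms(3,4)] .
  moreover have "path_between A (S \<union> B) u b (card S + card B - 1)"
    using path_between_append[OF p1 full assms(3,4)] pos by simp
  ultimately show ?thesis unfolding good_def using fin c by auto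
qed

lemma gapped_clique:
  assumes "finite K" "\<And>x y. x \<in> K \<Longrightarrow> y \<in> K \<Longrightarrow> x \<noteq> y \<Longrightarrow> A x y" "u \<in> K" "v \<in> K" "u \<noteq> v"
  shows "gapped A K u v"
proof -
  have "2 \<le> card K"
    using assms card_mono[of K "{u, v}"] by auto
  have "path_between A K u v l \<or> path_between A K u v (Suc l)" if "1 \<le> l" "l \<le> card K" for l
  \<comment> \<open>Distinct end points rule out a path on one vertex; this is the only gap, and two
    vertices bridge it.\<close>
  proof (cases "l = 1")
    case True
    then show ?thesis using path_between_clique[where A=A and l=2, OF assms] \<open>2 \<le> card K\<close>
      by (simp add: numeral_2_eq_2)
  next
    case False
    then show ?thesis using path_between_clique[where A=A and l=l, OF assms] that by simp
  qed
  then show ?thesis unfolding gapped_def using assms by blast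
qed

lemma gapped_singleton: "gapped A {u} u u"
  unfolding gapped_def using path_between_singleton[of A u] by auto

lemma cycle_in_clique:
  assumes "finite K" "\<And>x y. x \<in> K \<Longrightarrow> y \<in> K \<Longrightarrow> x \<noteq> y \<Longrightarrow> A x y" "3 \<le> l" "l \<le> card K"
  shows "cycle_in A K l"
proof -
  obtain x y where xy: "x \<in> K" "y \<in> K" "x \<noteq> y"
    using assms(3,4) card_le_Suc0_iff_eq[OF assms(1)]
    by (metis One_nat_def Suc_1 not_less_eq_eq numeral_3_eq_3 order_trans le_SucI)
  then show ?thesis
    using path_between_clique[where A=A and l=l, OF assms(1,2) xy] assms(3,4) cycle_in_close[of A K x y l] assms(2)[of y x] xy by auto
qed

lemma good_clique:
  assumes "finite K" "\<And>x y. x \<in> K \<Longrightarrow> y \<in> K \<Longrightarrow> x \<noteq> y \<Longrightarrow> A x y" "u \<in> K" "v \<in> K" "u \<noteq> v"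
    "3 \<le> card K"
  shows "good A u K v"
proof -
  have "path_between A K u v (card K)" "path_between A K u v (card K - 1)"
    using path_between_clique[where A=A, OF assms(1-5)] assms(6) by auto
  then show ?thesis unfolding good_def using cycle_in_clique[where A=A, OF assms(1,2)] assms(1) by blast
qed

text \<open>The library describes a cycle by its list of arcs, while the constructions produce the
  list of its vertices; this converts the latter into the former.\<close>

lemma pancyclicI:
  fixes G :: "'v pair_pre_digraph"
  assumes "\<And>l. 3 \<le> l \<Longrightarrow> l \<le> card (pverts G) \<Longrightarrow> cycle_in (\<lambda>x y. (x, y) \<in> parcs G) (pverts G) l"
  shows "pancyclic (with_proj G)"
  unfolding pancyclic_def with_proj_simps
proof (intro allI impI, elim conjE)
  fix l assume "3 \<le> l" "l \<le> card (pverts G)"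
  then obtain vs where vs: "vs \<noteq> []" "distinct vs" "successively (\<lambda>x y. (x, y) \<in> parcs G) vs"
      "(last vs, hd vs) \<in> parcs G" "set vs \<subseteq> pverts G" "length vs = l"
    using assms unfolding cycle_in_def by blast
  \<comment> \<open>The arcs of the walk that runs through \<open>ws\<close> and then steps to
    \<open>y\<close>. Leaving \<open>y\<close> free makes the induction over \<open>ws\<close> go
    through; afterwards \<open>y\<close> is the first vertex.\<close>
  define W where "W y ws = zip ws (tl ws @ [y])" for y :: 'v and ws
  have walk: "set (W y ws) \<subseteq> parcs G \<and> pcas (hd ws) (W y ws) y \<and> pawalk_verts (hd ws) (W y ws) = ws @ [y]"
    if "ws \<noteq> []" "successively (\<lambda>x y. (x, y) \<in> parcs G) ws" "(last ws, y) \<in> parcs G" for y ws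
    using that
  proof (induction ws rule: induct_list012)
    case (3 a b ws)
    then have "W y (a # b # ws) = (a, b) # W y (b # ws)" by (simp add: W_def)
    then show ?case using 3 by simp
  qed (simp_all add: W_def)
  obtain x xs where x: "vs = x # xs" using vs(1) by (cases vs) auto
  have "set (W x vs) \<subseteq> parcs G" "pcas x (W x vs) x" "pawalk_verts x (W x vs) = x # xs @ [x]"
    using walk[of vs x] vs x by auto
  moreover have "W x vs \<noteq> []" "length (W x vs) = l" using vs x by (simp_all add: W_def)
  ultimately have "pre_digraph.cycle (with_proj G) (W x vs)"
    unfolding pre_digraph.cycle_def pre_digraph.awalk_def cas_with_proj_eq awalk_verts_with_proj_eq
    using vs x by (intro exI[of _ x]) simp
  then show "\<exists>p. pre_digraph.cycle (with_proj G) p \<and> length p = l"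
    using \<open>length (W x vs) = l\<close> by blast
qed

text \<open>The relations used in the constructions may relate a vertex to itself, which a simple
  graph forbids. In a list without repetition consecutive entries differ, and from three vertices on
  so do the first and the last.\<close>

lemma cycle_in_irrefl:
  assumes "cycle_in A S l" "3 \<le> l"
  shows "cycle_in (\<lambda>x y. x \<in> S \<and> y \<in> S \<and> x \<noteq> y \<and> A x y) S l"
proof -
  obtain p where p: "p \<noteq> []" "distinct p" "successively A p" "A (last p) (hd p)" "set p \<subseteq> S" "length p = l"
    using assms(1) unfolding cycle_in_def by blast
  have "successively (\<lambda>x y. x \<in> S \<and> y \<in> S \<and> x \<noteq> y \<and> A x y) p"
    using p(2,3,5) by (induction p rule: induct_list012) auto
  moreover have "hd p \<noteq> last p"
    using p(1,2,6) assms(2) by (cases p) auto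
  moreover have "hd p \<in> S" "last p \<in> S" using p(1,5) by auto
  ultimately show ?thesis unfolding cycle_in_def using p by (intro exI[of _ p]) auto
qed

lemma cycle_in_image:
  assumes "cycle_in A S l" "inj_on f S" "f ` S \<subseteq> T" "\<And>x y. x \<in> S \<Longrightarrow> y \<in> S \<Longrightarrow> A x y \<Longrightarrow> B (f x) (f y)"
  shows "cycle_in B T l"
proof -
  obtain p where p: "p \<noteq> []" "distinct p" "successively A p" "A (last p) (hd p)" "set p \<subseteq> S" "length p = l"
    using assms(1) unfolding cycle_in_def by blast
  have "successively (\<lambda>x y. B (f x) (f y)) p"
    by (rule successively_mono[OF p(3)]) (use p(5) assms(4) in auto)
  moreover have "B (f (last p)) (f (hd p))"
    using p(1,4,5) assms(4)[of "last p" "hd p"] last_in_set hd_in_set by (metis subsetD)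
  moreover have "distinct (map f p)" using p(2,5) assms(2) inj_on_subset by (auto simp: distinct_map)
  moreover have "set (map f p) \<subseteq> T" using p(5) assms(3) by auto
  ultimately show ?thesis unfolding cycle_in_def
    using p by (intro exI[of _ "map f p"]) (auto simp: successively_map last_map hd_map)
qed

section \<open>Cycles in two coordinates\<close>

text \<open>This is what the cycle constructions use of the ring: an involution on the non-zero
  rows, standing for inversion in the residue field, and a symmetric relation between
  columns.\<close>

locale two_coordinates =
  fixes K :: "'k set" and zero one :: 'k and recip :: "'k \<Rightarrow> 'k"
    and M J :: "'m set" and r :: "'m \<Rightarrow> 'm \<Rightarrow> bool"
  assumes finite_K: "finite K" and finite_M: "finite M"
    and zero_K: "zero \<in> K" and one_K: "one \<in> K" and one_neq_zero: "one \<noteq> zero"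
    and J_M: "J \<subseteq> M" and J_ne: "J \<noteq> {}"
    and recip_K: "\<And>y. y \<in> K - {zero} \<Longrightarrow> recip y \<in> K - {zero}"
    and recip_recip: "\<And>y. y \<in> K - {zero} \<Longrightarrow> recip (recip y) = y"
    and recip_one: "recip one = one"
    and r_sym: "\<And>m n. r m n \<Longrightarrow> r n m"
begin

text \<open>In the application \<open>(y, m)\<close> stands for the ring element \<open>y + m\<close>, where \<open>M\<close> is a maximal ideal,
  \<open>J\<close> the Jacobson radical and \<open>K\<close> a system of representatives of the residue field of \<open>M\<close>.
  Only part of the adjacency relation of the Jacobson graph is needed.\<close>

definition adj :: "'k \<times> 'm \<Rightarrow> 'k \<times> 'm \<Rightarrow> bool" where
  "adj p q \<longleftrightarrow> fst p \<in> K - {zero} \<and> fst q = recip (fst p) \<or> r (snd p) (snd q)"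

definition vertices :: "('k \<times> 'm) set" where
  "vertices = K \<times> M - {zero} \<times> J"

lemma adj_row: "y \<in> K - {zero} \<Longrightarrow> adj (y, m) (recip y, n)"
  unfolding adj_def by simp

lemma adj_col: "r m n \<Longrightarrow> adj (y, m) (z, n)"
  unfolding adj_def by simp

lemma clique_row:
  assumes "y \<in> K - {zero}" "recip y = y" "p \<in> {y} \<times> M" "q \<in> {y} \<times> M"
  shows "adj p q"
  using assms unfolding adj_def by auto

text \<open>Each column of \<open>L\<close> is crossed from row \<open>y\<close> to row
  \<open>z\<close>. A column \<open>m\<close> in \<open>Q\<close> makes a detour through row
  \<open>zero\<close>; with \<tau> sending \<open>m\<close> to a column that is
  \<open>r\<close>-related to it, the detour vertex is adjacent to both ends. Each detour lengthens
  the path by one.\<close>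

definition triples :: "('m \<Rightarrow> 'm) \<Rightarrow> 'k \<Rightarrow> 'k \<Rightarrow> 'm set \<Rightarrow> 'm list \<Rightarrow> ('k \<times> 'm) list" where
  "triples \<tau> y z Q L = concat (map (\<lambda>m. (y, m) # (if m \<in> Q then [(zero, \<tau> m)] else []) @ [(z, m)]) L)"

lemma triples_simps:
  "triples \<tau> y z Q [] = []"
  "triples \<tau> y z Q (m # L) =
     (y, m) # (if m \<in> Q then [(zero, \<tau> m)] else []) @ [(z, m)] @ triples \<tau> y z Q L"
  unfolding triples_def by auto

lemma triples_set: "set (triples \<tau> y z Q L) = {y, z} \<times> set L \<union> {zero} \<times> \<tau> ` (Q \<inter> set L)"
  by (induction L) (auto simp: triples_simps)

lemma triples_eq_Nil: "triples \<tau> y z Q L = [] \<longleftrightarrow> L = []"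
  by (cases L) (auto simp: triples_simps)

lemma triples_hd: "L \<noteq> [] \<Longrightarrow> hd (triples \<tau> y z Q L) = (y, hd L)"
  by (cases L) (auto simp: triples_simps)

lemma triples_last: "L \<noteq> [] \<Longrightarrow> last (triples \<tau> y z Q L) = (z, last L)"
  by (induction L) (auto simp: triples_simps triples_eq_Nil)

lemma triples_length: "distinct L \<Longrightarrow> length (triples \<tau> y z Q L) = 2 * length L + card (Q \<inter> set L)"
  by (induction L) (auto simp: triples_simps)

lemma triples_distinct:
  assumes "distinct L" "y \<noteq> z" "y \<noteq> zero" "z \<noteq> zero" "inj_on \<tau> Q"
  shows "distinct (triples \<tau> y z Q L)"
  using assms by (induction L) (auto simp: triples_simps triples_set dest: inj_onD)

lemma triples_successively:
  assumes "y \<in> K - {zero}" "\<And>m. m \<in> Q \<Longrightarrow> r m (\<tau> m)"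
  shows "successively adj (triples \<tau> y (recip y) Q L)"
proof (induction L)
  case (Cons m L)
  have 1: "adj (y, m) (recip y, m)" "\<And>n. adj (recip y, m) (y, n)"
    using adj_row[OF assms(1)] adj_row[OF recip_K[OF assms(1)]] recip_recip[OF assms(1)] by auto
  have 2: "m \<in> Q \<Longrightarrow> adj (y, m) (zero, \<tau> m)" "m \<in> Q \<Longrightarrow> adj (zero, \<tau> m) (recip y, m)"
    using assms(2) r_sym adj_col by blast+
  show ?case
    using Cons 1 2
    by (cases "L = []")
      (auto simp: triples_simps successively_append_iff successively_Cons triples_eq_Nil triples_hd)
qed (simp add: triples_simps)

text \<open>Two mutually inverse rows are completely joined, so any order of the columns works.
  Column \<open>g\<close> is kept out of \<open>L\<close> and \<open>Q\<close> so that the exit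
  vertex \<open>(recip y, g)\<close> can come last.\<close>

lemma path_row_pair:
  assumes y: "y \<in> K - {zero}" "recip y \<noteq> y"
    and L: "distinct L" "set L \<subseteq> M - {g}" and g: "g \<in> M"
    and Q: "Q \<subseteq> set L" "inj_on \<tau> Q" "\<And>m. m \<in> Q \<Longrightarrow> r m (\<tau> m)"
    and s: "s = g \<or> L \<noteq> [] \<and> hd L = s"
  shows "path_between adj ({y, recip y} \<times> M \<union> {zero} \<times> \<tau> ` Q) (y, s) (recip y, g)
           (2 * length L + 2 + card Q)"
proof -
  have iy: "recip y \<in> K - {zero}" "recip (recip y) = y" using y recip_K recip_recip by auto
  have e: "\<And>m n. adj (y, m) (recip y, n)" "\<And>m n. adj (recip y, m) (y, n)"
    using adj_row[OF y(1)] adj_row[OF iy(1)] iy(2) by auto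
  have Qi: "Q \<inter> set L = Q" using Q by blast
  show ?thesis
  proof (cases "s = g")
    case True
    \<comment> \<open>Entry and exit share column \<open>g\<close>: its two vertices become the
      ends, and the columns between them are crossed in the opposite direction.\<close>
    let ?p = "(y, g) # triples \<tau> (recip y) y Q L @ [(recip y, g)]"
    have tr: "successively adj (triples \<tau> (recip y) y Q L)"
      using triples_successively[OF iy(1), of Q \<tau> L] Q(3) iy(2) by simp
    show ?thesis
      using L Q y iy g True tr e Qi
      by (intro path_betweenI[of ?p])
        (auto simp: triples_set triples_length triples_distinct successively_append_iff
          successively_Cons triples_eq_Nil triples_hd triples_last hd_append last_append)
  next
    case False
    then have L0: "L \<noteq> []" "hd L = s" using s by auto
    \<comment> \<open>The entry lies in the first column of \<open>L\<close>; column
      \<open>g\<close> is crossed at the end, without a detour.\<close>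
    let ?p = "triples \<tau> y (recip y) Q L @ [(y, g), (recip y, g)]"
    have tr: "successively adj (triples \<tau> y (recip y) Q L)"
      using triples_successively[OF y(1), of Q \<tau> L] Q(3) by simp
    show ?thesis
      using L Q y iy g L0 tr e Qi
      by (intro path_betweenI[of ?p])
        (auto simp: triples_set triples_length triples_distinct successively_append_iff
          successively_Cons triples_eq_Nil triples_hd triples_last hd_append last_append)
  qed
qed

lemma distinct_list_with_hd:
  assumes "finite B" "n \<le> card B" "1 \<le> n" "s \<in> B"
  shows "\<exists>L. distinct L \<and> set L \<subseteq> B \<and> length L = n \<and> hd L = s \<and> L \<noteq> []"
proof -
  have "n - 1 \<le> card (B - {s})" using assms by simp
  then obtain T where T: "T \<subseteq> B - {s}" "card T = n - 1" "finite T"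
    using assms(1) by (meson finite_Diff obtain_subset_with_card_n)
  obtain xs where xs: "set xs = T" "distinct xs" using finite_distinct_list[OF T(3)] by blast
  then have "length xs = n - 1" using T distinct_card by fastforce
  then show ?thesis using xs T assms by (intro exI[of _ "s # xs"]) auto
qed

lemma distinct_list_of_length:
  assumes "finite B" "n \<le> card B"
  shows "\<exists>L. distinct L \<and> set L \<subseteq> B \<and> length L = n"
proof -
  obtain T where T: "T \<subseteq> B" "card T = n" "finite T"
    using assms by (meson obtain_subset_with_card_n)
  obtain xs where xs: "set xs = T" "distinct xs" using finite_distinct_list[OF T(3)] by blast
  then have "length xs = n" using T distinct_card by fastforce
  then show ?thesis using xs T by blast
qed

text \<open>With row edges alone, a path between the two rows alternates and has even length. Beyond
  \<open>2 * card M\<close> all columns are in use and every detour through row \<open>zero\<close>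
  adds one vertex. So no two consecutive lengths are missing.\<close>

lemma gapped_row_pair:
  assumes y: "y \<in> K - {zero}" "recip y \<noteq> y" and g: "g \<in> M" and s: "s \<in> M"
    and Q: "Q \<subseteq> M - {g}" "inj_on \<tau> Q" "\<And>m. m \<in> Q \<Longrightarrow> r m (\<tau> m)"
  shows "gapped adj ({y, recip y} \<times> M \<union> {zero} \<times> \<tau> ` Q) (y, s) (recip y, g)"
proof -
  let ?B = "{y, recip y} \<times> M \<union> {zero} \<times> \<tau> ` Q"
  let ?N = "card M"
  have finQ: "finite Q" using Q(1) finite_M by (meson finite_Diff finite_subset)
  have N1: "1 \<le> ?N" "card (M - {g}) = ?N - 1"
    using g finite_M by (auto simp: Suc_le_eq card_gt_0_iff)
  have "card ?B = card ({y, recip y} \<times> M) + card ({zero} \<times> \<tau> ` Q)"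
    using y recip_K[OF y(1)] finite_M finQ by (intro card_Un_disjoint) auto
  then have cB: "card ?B = 2 * ?N + card Q"
    using y Q(2) by (simp add: card_cartesian_product card_image)
  have list: "\<exists>L. distinct L \<and> set L \<subseteq> M - {g} \<and> length L = n \<and> (s = g \<or> L \<noteq> [] \<and> hd L = s)"
    if "n \<le> ?N - 1" "s = g \<or> 1 \<le> n" for n
  proof (cases "s = g")
    case True
    then show ?thesis using distinct_list_of_length[of "M - {g}" n] that(1) finite_M N1(2) by simp
  next
    case False
    then show ?thesis
      using distinct_list_with_hd[of "M - {g}" n s] that finite_M N1(2) s by simp blast
  qed
  have even: "path_between adj ?B (y, s) (recip y, g) (2 * t)" if t: "1 \<le> t" "t \<le> ?N" for t
  proof (cases "t = 1 \<and> s \<noteq> g")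
    \<comment> \<open>The list of columns would have to begin with \<open>s\<close> but must be
      empty for this length; the direct edge replaces it.\<close>
    case True
    then show ?thesis
      using y s g recip_K[OF y(1)] adj_row[OF y(1), of s g]
      by (intro path_betweenI[of "[(y, s), (recip y, g)]"]) simp_all
  next
    case False
    have "t - 1 \<le> ?N - 1" using t(2) by (rule diff_le_mono)
    moreover have "s = g \<or> 1 \<le> t - 1" using False t(1) by linarith
    ultimately have "t - 1 \<le> ?N - 1" "s = g \<or> 1 \<le> t - 1" .
    from list[OF this] obtain L :: "'m list" where L: "distinct L" "set L \<subseteq> M - {g}" "length L = t - 1"
        "s = g \<or> L \<noteq> [] \<and> hd L = s"
      by (elim exE conjE)
    have "path_between adj ({y, recip y} \<times> M \<union> {zero} \<times> \<tau> ` {}) (y, s) (recip y, g)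
            (2 * length L + 2 + card ({} :: 'm set))"
      by (rule path_row_pair[OF y L(1,2) g _ _ _ L(4)]) auto
    moreover have "2 * length L + 2 + card ({} :: 'm set) = 2 * t" using L(3) t by simp
    ultimately have "path_between adj ({y, recip y} \<times> M \<union> {zero} \<times> \<tau> ` {}) (y, s) (recip y, g) (2 * t)"
      by metis
    then show ?thesis by (rule path_between_mono) blast
  qed
  have large: "path_between adj ?B (y, s) (recip y, g) (2 * ?N + q)" if q: "1 \<le> q" "q \<le> card Q" for q
  proof -
    obtain T where T: "T \<subseteq> Q" "card T = q" using q by (meson obtain_subset_with_card_n)
    \<comment> \<open>A non-empty \<open>Q\<close> that avoids \<open>g\<close> forces a second
      column, so a list beginning with \<open>s\<close> exists also for \<open>s\<close> different
      from \<open>g\<close>.\<close>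
    have "card Q \<le> ?N - 1" using card_mono[OF _ Q(1)] finite_M N1(2) by simp
    then have "?N - 1 \<le> ?N - 1" "s = g \<or> 1 \<le> ?N - 1" using q by auto
    from list[OF this] obtain L :: "'m list" where L: "distinct L" "set L \<subseteq> M - {g}" "length L = ?N - 1"
        "s = g \<or> L \<noteq> [] \<and> hd L = s"
      by (elim exE conjE)
    have "set L = M - {g}"
      using card_subset_eq[OF _ L(2)] finite_M N1(2) L(3) distinct_card[OF L(1)] by simp
    then have TL: "T \<subseteq> set L" using T Q by blast
    have "path_between adj ({y, recip y} \<times> M \<union> {zero} \<times> \<tau> ` T) (y, s) (recip y, g)
            (2 * length L + 2 + card T)"
      by (rule path_row_pair[OF y L(1,2) g TL _ _ L(4)])
        (use T(1) Q(2,3) inj_on_subset in blast)+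
    moreover have "2 * length L + 2 + card T = 2 * ?N + q" using L(3) N1 T by simp
    ultimately have "path_between adj ({y, recip y} \<times> M \<union> {zero} \<times> \<tau> ` T) (y, s) (recip y, g) (2 * ?N + q)"
      by metis
    then show ?thesis by (rule path_between_mono) (use T(1) in blast)
  qed
  have "path_between adj ?B (y, s) (recip y, g) l \<or> path_between adj ?B (y, s) (recip y, g) (Suc l)"
    if l: "1 \<le> l" "l \<le> card ?B" for l
  proof (cases "l \<le> 2 * ?N")
    case True
    show ?thesis
    proof (cases "even l")
      case True
      then obtain t where "l = 2 * t" by blast
      then show ?thesis using even[of t] l \<open>l \<le> 2 * ?N\<close> by auto
    next
      case False
      then obtain t where "l = 2 * t + 1" using oddE by blast
      then show ?thesis using even[of "t + 1"] l \<open>l \<le> 2 * ?N\<close> by auto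
    qed
  next
    case False
    then show ?thesis using large[of "l - 2 * ?N"] l cB by auto
  qed
  moreover have "finite ?B" "?B \<noteq> {}" using finite_M finQ g by auto
  ultimately show ?thesis unfolding gapped_def by simp
qed

text \<open>Induction on the number of rows left. Every pair is entered and left in column
  \<open>g\<close>, where \<open>r g g\<close> makes all vertices adjacent; hence the invariant
  \<open>snd v = g\<close>.\<close>

lemma good_add_row_pairs:
  assumes "finite C" "C \<subseteq> K - {zero}" "\<And>y. y \<in> C \<Longrightarrow> recip y \<in> C \<and> recip y \<noteq> y"
    and "good adj (one, g) S v" "S \<inter> C \<times> M = {}" "snd v = g" "g \<in> M" "r g g"
  shows "\<exists>v'. good adj (one, g) (S \<union> C \<times> M) v'"
  using assms
proof (induction "card C" arbitrary: C S v rule: less_induct)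
  case less
  show ?case
  proof (cases "C = {}")
    case True
    then show ?thesis using less.prems(4) by (intro exI[of _ v]) simp
  next
    case False
    then obtain y where y: "y \<in> C" by blast
    define z where "z = recip y"
    have z: "z \<in> C" "z \<noteq> y" "recip z = y" "y \<in> K - {zero}" "z \<in> K - {zero}"
      using less.prems(2,3) y recip_recip z_def by auto
    have "gapped adj ({y, z} \<times> M) (y, g) (z, g)"
      using gapped_row_pair[of y g g "{}" id] z y less.prems(7) z_def by auto
    moreover have "adj v (y, g)" "adj (z, g) (one, g)"
      using less.prems(6,8) by (auto intro: adj_col simp: adj_def)
    moreover have "S \<inter> {y, z} \<times> M = {}" using less.prems(5) y z by blast
    ultimately have g': "good adj (one, g) (S \<union> {y, z} \<times> M) (z, g)"
      by (intro good_extend[OF less.prems(4)]) auto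
    have "\<exists>v'. good adj (one, g) ((S \<union> {y, z} \<times> M) \<union> (C - {y, z}) \<times> M) v'"
    proof (rule less.hyps[OF _ _ _ _ g'])
      show "card (C - {y, z}) < card C"
        using y less.prems(1) by (intro psubset_card_mono) auto
      show "finite (C - {y, z})" using less.prems(1) by simp
      show "C - {y, z} \<subseteq> K - {zero}" using less.prems(2) by blast
      show "recip x \<in> C - {y, z} \<and> recip x \<noteq> x" if "x \<in> C - {y, z}" for x
      proof -
        have "x \<in> C" "x \<in> K - {zero}" using that less.prems(2) by auto
        then show ?thesis
          using that less.prems(3)[of x] recip_recip[of x] z(3) z_def by (metis Diff_iff insert_iff empty_iff)
      qed
      show "(S \<union> {y, z} \<times> M) \<inter> (C - {y, z}) \<times> M = {}" using less.prems(5) by blast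
    qed (use less.prems in auto)
    moreover have "(S \<union> {y, z} \<times> M) \<union> (C - {y, z}) \<times> M = S \<union> C \<times> M" using y z by blast
    ultimately show ?thesis by simp
  qed
qed

text \<open>The blocks are attached in this order: row \<open>one\<close>, row \<open>w\<close> if
  it is different, the pair of rows of \<open>y\<close> together with row \<open>zero\<close> except
  for \<open>(zero, g)\<close>, then \<open>(zero, g)\<close>, then all other pairs. In the ring,
  \<open>w\<close> is the row of -1 and \<tau> a bijective choice of inverses.\<close>

lemma cycles_if_not_involutory:
  assumes g: "g \<in> M - J" "r g g"
    and \<tau>: "bij_betw \<tau> (M - J) (M - J)" "\<And>m. m \<in> M - J \<Longrightarrow> r m (\<tau> m)" "\<tau> g = g"
    and d: "d \<in> M - J" "d \<noteq> g"
    and w: "w \<in> K - {zero}" "recip w = w" "\<And>y. y \<in> K - {zero} \<Longrightarrow> recip y = y \<Longrightarrow> y = one \<or> y = w"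
    and y: "y \<in> K - {zero}" "recip y \<noteq> y"
    and l: "3 \<le> l" "l \<le> card vertices"
  shows "cycle_in adj vertices l"
proof -
  \<comment> \<open>The path through row \<open>one\<close> ends in \<open>(one, d)\<close>, and
    \<open>s\<close> is the column in which the next block can be entered from there.\<close>
  define s where "s = \<tau> d"
  have s: "s \<in> M - J" "r d s" "s \<noteq> g"
    using \<tau> d g unfolding s_def bij_betw_def by (auto dest: inj_onD)
  have one: "one \<in> K - {zero}" using one_K one_neq_zero by simp
  obtain j where j: "j \<in> J" using J_ne by blast
  have "3 \<le> card M"
  proof -
    have "j \<noteq> g" "j \<noteq> d" using j g d by auto
    then have "card {j, g, d} = 3" using d by simp
    moreover have "{j, g, d} \<subseteq> M" using j g d J_M by auto
    ultimately show ?thesis using card_mono[OF finite_M] by metis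
  qed
  then have good1: "good adj (one, g) ({one} \<times> M) (one, d)"
    using g d finite_M clique_row[OF one recip_one]
    by (intro good_clique) (auto simp: card_cartesian_product)
  \<comment> \<open>If \<open>w = one\<close>, as in characteristic 2, the pair of rows is entered
    from \<open>(one, d)\<close> in column \<open>s\<close>. Otherwise row \<open>w\<close> comes
    between, and its exit \<open>(w, g)\<close> leads to column \<open>g\<close>.\<close>
  have "\<exists>S v t. good adj (one, g) S v \<and> S = {one, w} \<times> M \<and> t \<in> M \<and> adj v (y, t)"
  proof (cases "w = one")
    case True
    then show ?thesis
      using good1 s by (intro exI[of _ "{one} \<times> M"] exI[of _ "(one, d)"] exI[of _ s]) (simp add: adj_col)
  next
    case False
    have "gapped adj ({w} \<times> M) (w, s) (w, g)"
      using g s finite_M clique_row[OF w(1,2)] by (intro gapped_clique) auto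
    then have "good adj (one, g) ({one} \<times> M \<union> {w} \<times> M) (w, g)"
      using False g s by (intro good_extend[OF good1]) (auto intro: adj_col)
    moreover have "{one} \<times> M \<union> {w} \<times> M = {one, w} \<times> M" by blast
    ultimately show ?thesis
      using g by (intro exI[of _ "{one, w} \<times> M"] exI[of _ "(w, g)"] exI[of _ g]) (simp add: adj_col)
  qed
  then obtain v t where vt: "good adj (one, g) ({one, w} \<times> M) v" "t \<in> M" "adj v (y, t)" by blast
  define z where "z = recip y"
  have z: "z \<in> K - {zero}" "recip z = y" "z \<noteq> y" "z \<noteq> one" "z \<noteq> w" "y \<noteq> one" "y \<noteq> w"
    using y w recip_K recip_recip recip_one unfolding z_def by auto
  \<comment> \<open>Since \<tau> fixes \<open>g\<close>, it permutes the remaining columns of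
    \<open>M - J\<close>, so the detours reach every vertex of row \<open>zero\<close> but
    \<open>(zero, g)\<close>.\<close>
  define Q where "Q = M - J - {g}"
  have Q: "\<tau> ` Q = Q"
  proof -
    have "\<tau> ` ((M - J) - {g}) = \<tau> ` (M - J) - \<tau> ` {g}"
      using \<tau>(1) g by (intro inj_on_image_set_diff[where C = "M - J"]) (auto simp: bij_betw_def)
    then show ?thesis using \<tau>(1,3) by (simp add: Q_def bij_betw_def)
  qed
  have "gapped adj ({y, z} \<times> M \<union> {zero} \<times> \<tau> ` Q) (y, t) (z, g)"
    unfolding z_def
    by (rule gapped_row_pair[OF y]) (use g vt \<tau> in \<open>auto simp: Q_def bij_betw_def intro: inj_on_subset\<close>)
  then have gW: "gapped adj ({y, z} \<times> M \<union> {zero} \<times> Q) (y, t) (z, g)" using Q by simp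
  have g2: "good adj (one, g) ({one, w} \<times> M \<union> ({y, z} \<times> M \<union> {zero} \<times> Q)) (z, g)"
    by (rule good_extend[OF vt(1) gW])
      (use z y w one vt(3) adj_col[OF g(2)] in auto)
  have g3: "good adj (one, g) (({one, w} \<times> M \<union> ({y, z} \<times> M \<union> {zero} \<times> Q)) \<union> {(zero, g)}) (zero, g)"
    by (rule good_extend[OF g2 gapped_singleton])
      (use z y w one adj_col[OF g(2)] in \<open>auto simp: Q_def\<close>)
  define C where "C = K - {zero, one, w, y, z}"
  have "\<exists>v'. good adj (one, g) ((({one, w} \<times> M \<union> ({y, z} \<times> M \<union> {zero} \<times> Q)) \<union> {(zero, g)}) \<union> C \<times> M) v'"
  proof (rule good_add_row_pairs[OF _ _ _ g3])
    show "finite C" using finite_K C_def by simp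
    show "C \<subseteq> K - {zero}" using C_def by blast
    show "recip x \<in> C \<and> recip x \<noteq> x" if "x \<in> C" for x
    proof -
      have x: "x \<in> K - {zero}" "x \<noteq> one" "x \<noteq> w" "x \<noteq> y" "x \<noteq> z" using that C_def by auto
      have "recip x \<noteq> x" using w(3)[OF x(1)] x by blast
      moreover have "recip x \<noteq> one" "recip x \<noteq> w" "recip x \<noteq> y" "recip x \<noteq> z"
        using recip_recip[OF x(1)] x(2-5) recip_one w(2) z(2) z_def by metis+
      ultimately show ?thesis using recip_K[OF x(1)] C_def by blast
    qed
    show "(({one, w} \<times> M \<union> ({y, z} \<times> M \<union> {zero} \<times> Q)) \<union> {(zero, g)}) \<inter> C \<times> M = {}"
      unfolding C_def by blast
  qed (use g in simp_all)
  moreover have "((({one, w} \<times> M \<union> ({y, z} \<times> M \<union> {zero} \<times> Q)) \<union> {(zero, g)}) \<union> C \<times> M) = vertices"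
  proof (rule Set.set_eqI)
    fix p :: "'k \<times> 'm"
    obtain k m where p: "p = (k, m)" by fastforce
    have "w \<noteq> zero" "y \<noteq> zero" "z \<noteq> zero" "w \<in> K" "y \<in> K" "z \<in> K" using w(1) y(1) z(1) by auto
    then show "p \<in> (({one, w} \<times> M \<union> ({y, z} \<times> M \<union> {zero} \<times> Q)) \<union> {(zero, g)}) \<union> C \<times> M \<longleftrightarrow> p \<in> vertices"
      using one_K one_neq_zero zero_K g(1) unfolding p vertices_def C_def Q_def by (cases "k = zero") auto
  qed
  ultimately show ?thesis using l unfolding good_def by auto
qed

text \<open>Unlike in \<open>triples\<close>, the rows \<open>a\<close> and \<open>b\<close> are
  meant to be self-inverse, that is cliques: the next column is crossed in the opposite direction,
  starting from the row just reached. The detours stay in their column.\<close>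

fun zigzag :: "'m set \<Rightarrow> 'k \<Rightarrow> 'k \<Rightarrow> 'm list \<Rightarrow> ('k \<times> 'm) list" where
  "zigzag Q a b [] = []"
| "zigzag Q a b (x # xs) =
     (a, x) # (if x \<in> Q then [(zero, x)] else []) @ [(b, x)] @ zigzag Q b a xs"

lemma zigzag_set: "set (zigzag Q a b L) = {a, b} \<times> set L \<union> {zero} \<times> (Q \<inter> set L)"
  by (induction L arbitrary: a b) auto

lemma zigzag_eq_Nil: "zigzag Q a b L = [] \<longleftrightarrow> L = []"
  by (cases L) auto

lemma zigzag_hd: "L \<noteq> [] \<Longrightarrow> hd (zigzag Q a b L) = (a, hd L)"
  by (cases L) auto

text \<open>An odd number of crossings ends in the other row; this decides the parity in the long
  cycle.\<close>

lemma zigzag_last: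
  "L \<noteq> [] \<Longrightarrow> last (zigzag Q a b L) = (if odd (length L) then b else a, last L)"
  by (induction L arbitrary: a b) (auto simp: zigzag_eq_Nil)

lemma zigzag_distinct:
  assumes "distinct L" "a \<noteq> b" "a \<noteq> zero" "b \<noteq> zero"
  shows "distinct (zigzag Q a b L)"
  using assms by (induction L arbitrary: a b) (auto simp: zigzag_set)

lemma zigzag_successively:
  assumes "a \<in> K - {zero}" "recip a = a" "b \<in> K - {zero}" "recip b = b"
    and "\<And>m. m \<in> set L \<Longrightarrow> r m m"
  shows "successively adj (zigzag Q a b L)"
  using assms
proof (induction L arbitrary: a b)
  case (Cons x L)
  have "\<And>y z. adj (y, x) (z, x)" "\<And>n. adj (b, x) (b, n)"
    using Cons.prems adj_col[of x x] adj_row[of b x] by auto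
  moreover have "successively adj (zigzag Q b a L)" using Cons by simp
  ultimately show ?case
    by (cases "L = []")
      (auto simp: successively_append_iff successively_Cons zigzag_eq_Nil zigzag_hd)
qed simp

lemma row_successively:
  assumes "y \<in> K - {zero}" "recip y = y"
  shows "successively adj (map (Pair y) L)"
  using adj_row[OF assms(1)] assms(2)
  by (induction L rule: induct_list012) auto

text \<open>The list \<open>E\<close> corrects the parity: if \<open>M - J\<close> has odd size, one column \<open>d\<close> next to \<open>h\<close>
  is not used for changing between the rows \<open>a\<close> and \<open>b\<close>.\<close>

lemma long_cycle_if_two_rows:
  assumes a: "a \<in> K - {zero}" "recip a = a" and b: "b \<in> K - {zero}" "recip b = b" and "a \<noteq> b"
    and refl: "\<And>m. m \<in> M - J \<Longrightarrow> r m m"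
    and h: "h \<in> M - J" and E: "E = [] \<or> (\<exists>d \<in> M - J - {h}. r h d \<and> E = [d])"
    and odd: "odd (card (M - J - {h} - set E))" and Q: "Q \<subseteq> M - J"
  shows "cycle_in adj ({a, b} \<times> M \<union> {zero} \<times> Q) (2 * card M + card Q)"
proof -
  obtain js where js: "set js = J" "distinct js"
    using finite_distinct_list[of J] finite_M J_M finite_subset by metis
  have js0: "js \<noteq> []" using js J_ne by auto
  obtain L where L: "set L = M - J - {h} - set E" "distinct L"
    using finite_distinct_list[of "M - J - {h} - set E"] finite_M by auto
  have oddL: "odd (length L)" using L odd distinct_card by metis
  then have L0: "L \<noteq> []" by auto
  have row: "\<And>m n. adj (a, m) (a, n)" "\<And>m n. adj (b, m) (b, n)"
    using adj_row a b by metis+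
  have col: "\<And>y z m. m \<in> M - J \<Longrightarrow> adj (y, m) (z, m)"
    using adj_col refl by blast
  \<comment> \<open>For \<open>E = [d]\<close> with \<open>d\<close> in \<open>Q\<close>,
    \<open>r h d\<close> permits the step from \<open>(a, h)\<close> to \<open>(zero, d)\<close>,
    and \<open>r d d\<close> the step on to \<open>(a, d)\<close>.\<close>
  define e1 where "e1 = concat (map (\<lambda>d. (if d \<in> Q then [(zero, d)] else []) @ [(a, d)]) E)"
  define e2 where "e2 = (if h \<in> Q then [(zero, h)] else [])"
  \<comment> \<open>The cycle leaves column \<open>h\<close>, runs along \<open>J\<close> in row
    \<open>a\<close>, changes rows an odd number of times, returns along \<open>J\<close> in row
    \<open>b\<close> and closes up in column \<open>h\<close>, through \<open>(zero, h)\<close> if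
    that vertex is wanted.\<close>
  define p where "p = [(a, h)] @ e1 @ map (Pair a) js @ zigzag Q a b L @ map (Pair b) js
                      @ map (Pair b) E @ [(b, h)] @ e2"
  have dE: "distinct E" "set E \<subseteq> M - J - {h}" using E by auto
  have setp: "set p = {a, b} \<times> M \<union> {zero} \<times> Q"
  proof -
    have e: "set e1 = {a} \<times> set E \<union> {zero} \<times> (Q \<inter> set E)" "set e2 = {zero} \<times> (Q \<inter> {h})"
      unfolding e1_def e2_def by auto
    have "M = J \<union> {h} \<union> set E \<union> set L" "Q = (Q \<inter> set E) \<union> (Q \<inter> {h}) \<union> (Q \<inter> set L)"
      using L(1) J_M h dE(2) Q by auto
    then show ?thesis
      unfolding p_def set_append e zigzag_set by (auto simp: js(1))
  qed
  have "distinct e1" "distinct e2"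
    using E a unfolding e1_def e2_def by (auto split: if_splits)
  then have dist: "distinct p"
    using js(2) L(2) dE a(1) b(1) \<open>a \<noteq> b\<close> h zigzag_distinct[OF L(2) \<open>a \<noteq> b\<close>]
    unfolding p_def
    by (auto simp: distinct_map inj_on_def zigzag_set L(1) js(1) e1_def e2_def split: if_splits)
  have "card p' = 2 * card M + card Q" if "p' = {a, b} \<times> M \<union> {zero} \<times> Q" for p'
  proof -
    have "card p' = card ({a, b} \<times> M) + card ({zero} \<times> Q)"
      unfolding that using a b finite_M finite_subset[OF Q] by (intro card_Un_disjoint) auto
    then show ?thesis using \<open>a \<noteq> b\<close> by (simp add: card_cartesian_product)
  qed
  then have len: "length p = 2 * card M + card Q"
    using distinct_card[OF dist] setp by metis
  have s1: "successively adj ([(a, h)] @ e1)" "fst (last ([(a, h)] @ e1)) = a"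
  proof -
    have "adj (a, h) (zero, d) \<and> adj (zero, d) (a, d)" if "E = [d]" for d
      using E that adj_col col by auto
    then show "successively adj ([(a, h)] @ e1)" "fst (last ([(a, h)] @ e1)) = a"
      using E row(1) unfolding e1_def by (auto split: if_splits)
  qed
  have s3: "successively adj ([(b, h)] @ e2)" "snd (last ([(b, h)] @ e2)) = h"
    using col[OF h] unfolding e2_def by auto
  have zz: "successively adj (zigzag Q a b L)"
    by (rule zigzag_successively[OF a b]) (use L(1) refl in auto)
  have "successively adj (([(a, h)] @ e1) @ map (Pair a) js @ zigzag Q a b L @ map (Pair b) js
           @ map (Pair b) E @ ([(b, h)] @ e2))"
  proof -
    obtain x where x: "last ([(a, h)] @ e1) = (a, x)" using s1(2) by (metis prod.collapse)
    have r1: "successively adj (map (Pair b) js @ map (Pair b) E @ ([(b, h)] @ e2))"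
      using row_successively[OF b] s3 js0 row(2)
      by (cases "E = []") (auto simp: successively_append_iff last_map hd_append hd_map)
    have "successively adj (zigzag Q a b L @ (map (Pair b) js @ map (Pair b) E @ ([(b, h)] @ e2)))"
      using r1 zz zigzag_last[OF L0, of Q a b] oddL js0 row(2)
      by (subst successively_append_iff) (simp add: hd_map hd_append)
    then have "successively adj (map (Pair a) js @ zigzag Q a b L @ map (Pair b) js
           @ map (Pair b) E @ ([(b, h)] @ e2))"
      using row_successively[OF a] js0 L0 row(1)
      by (subst successively_append_iff) (simp add: last_map zigzag_hd zigzag_eq_Nil hd_append)
    then show ?thesis
      using s1(1) x js0 row(1)
      by (subst successively_append_iff) (simp add: hd_append hd_map)
  qed
  then have suc: "successively adj p" unfolding p_def by simp
  have "snd (last p) = h" "hd p = (a, h)" using s3(2) unfolding p_def e2_def by auto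
  then have "adj (last p) (hd p)" using refl[OF h] unfolding adj_def by simp
  then show ?thesis
    unfolding cycle_in_def using dist suc len setp by (intro exI[of _ p]) (auto simp: p_def)
qed

text \<open>There are three ranges of lengths: up to \<open>card M\<close> inside the clique row
  \<open>a\<close>, up to \<open>2 * card M\<close> by paths in both rows linked through columns
  \<open>h\<close> and \<open>x\<close>, and beyond that by adding a part \<open>Q\<close> of row
  \<open>zero\<close> to the two full rows.\<close>

lemma cycles_if_two_rows:
  assumes a: "a \<in> K - {zero}" "recip a = a" and b: "b \<in> K - {zero}" "recip b = b" and "a \<noteq> b"
    and K: "K = {zero, a, b}"
    and refl: "\<And>m. m \<in> M - J \<Longrightarrow> r m m"
    and h: "h \<in> M - J" and E: "E = [] \<or> (\<exists>d \<in> M - J - {h}. r h d \<and> E = [d])"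
    and odd: "odd (card (M - J - {h} - set E))"
    and l: "3 \<le> l" "l \<le> card vertices"
  shows "cycle_in adj vertices l"
proof -
  have "M - J - {h} - set E \<noteq> {}" using odd by force
  then obtain x where x: "x \<in> M - J" "x \<noteq> h" by auto
  obtain j where j: "j \<in> J" using J_ne by blast
  have "j \<noteq> x" "j \<noteq> h" using j x h by auto
  then have "card {j, x, h} = 3" using x by simp
  then have N3: "3 \<le> card M" using card_mono[OF finite_M, of "{j, x, h}"] j x h J_M by auto
  have V: "vertices = {a, b} \<times> M \<union> {zero} \<times> (M - J)"
    using K a b unfolding vertices_def by auto
  have cV: "card vertices = 2 * card M + card (M - J)"
  proof -
    have "card vertices = card ({a, b} \<times> M) + card ({zero} \<times> (M - J))"
      unfolding V using a b finite_M by (intro card_Un_disjoint) auto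
    then show ?thesis using \<open>a \<noteq> b\<close> by (simp add: card_cartesian_product)
  qed
  consider "l \<le> card M" | "card M < l" "l \<le> 2 * card M" | "2 * card M < l" by linarith
  then show ?thesis
  proof cases
    case 1
    have "cycle_in adj ({a} \<times> M) l"
      using cycle_in_clique[where A = adj and K = "{a} \<times> M" and l = l] clique_row[OF a] finite_M l 1
      by (simp add: card_cartesian_product)
    then show ?thesis using V by (auto intro: cycle_in_mono)
  next
    case 2
    \<comment> \<open>Both pieces have distinct ends, hence at least two vertices; just above
      \<open>card M\<close> the first piece is shortened for the sake of the second.\<close>
    define k where "k = (if l \<le> card M + 2 then l - 2 else card M)"
    have k: "2 \<le> k" "k \<le> card M" "2 \<le> l - k" "l - k \<le> card M" "k + (l - k) = l"
      using 2 l N3 unfolding k_def by (auto split: if_splits)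
    have "path_between adj ({a} \<times> M) (a, h) (a, x) k"
      by (rule path_between_clique)
        (use finite_M clique_row[OF a] h x k in \<open>auto simp: card_cartesian_product\<close>)
    moreover have "path_between adj ({b} \<times> M) (b, x) (b, h) (l - k)"
      by (rule path_between_clique)
        (use finite_M clique_row[OF b] h x k in \<open>auto simp: card_cartesian_product\<close>)
    ultimately have "path_between adj ({a} \<times> M \<union> {b} \<times> M) (a, h) (b, h) (k + (l - k))"
      using refl[OF x(1)] \<open>a \<noteq> b\<close> by (intro path_between_append) (auto intro: adj_col)
    then have "cycle_in adj ({a} \<times> M \<union> {b} \<times> M) l"
      using k(5) cycle_in_close adj_col[OF refl[OF h]] by metis
    then show ?thesis by (rule cycle_in_mono) (use V in blast)
  next
    case 3
    have "l - 2 * card M \<le> card (M - J)" using l cV by simp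
    then obtain Q where Q: "Q \<subseteq> M - J" "card Q = l - 2 * card M"
      by (meson obtain_subset_with_card_n)
    have "cycle_in adj ({a, b} \<times> M \<union> {zero} \<times> Q) l"
      using long_cycle_if_two_rows[OF a b \<open>a \<noteq> b\<close> refl h E odd Q(1)] Q(2) 3 by simp
    then show ?thesis by (rule cycle_in_mono) (use V Q in blast)
  qed
qed

text \<open>Here \<open>p\<close> orders the columns into a Hamiltonian path of row
  \<open>zero\<close>. An initial segment of it is closed up by a path of suitable length through
  the clique row \<open>one\<close>, between the columns of its two ends.\<close>

lemma cycles_if_one_row:
  assumes K: "K = {zero, one}" and refl: "\<And>m. m \<in> M - J \<Longrightarrow> r m m"
    and p: "distinct p" "set p = M - J" "successively r p" "2 \<le> length p"
    and l: "3 \<le> l" "l \<le> card vertices"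
  shows "cycle_in adj vertices l"
proof -
  have one: "one \<in> K - {zero}" using one_K one_neq_zero by simp
  note clique = clique_row[OF one recip_one]
  have V: "vertices = {one} \<times> M \<union> {zero} \<times> (M - J)"
    using K one_neq_zero unfolding vertices_def by auto
  have lp: "length p = card (M - J)" using p distinct_card by metis
  have cV: "card vertices = card M + length p"
  proof -
    have "card vertices = card ({one} \<times> M) + card ({zero} \<times> (M - J))"
      unfolding V using one_neq_zero finite_M by (intro card_Un_disjoint) auto
    then show ?thesis using lp by (simp add: card_cartesian_product)
  qed
  have NJ: "length p \<le> card M" using lp finite_M by (simp add: card_mono)
  show ?thesis
  proof (cases "l \<le> card M")
    case True
    have "cycle_in adj ({one} \<times> M) l"
      using cycle_in_clique[where A = adj and K = "{one} \<times> M" and l = l] clique finite_M l True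
      by (simp add: card_cartesian_product)
    then show ?thesis using V by (auto intro: cycle_in_mono)
  next
    case False
    have "M - J \<noteq> M" using J_M J_ne by auto
    then have "length p < card M" using lp finite_M psubset_card_mono[of M "M - J"] by auto
    \<comment> \<open>At least two columns are taken, so that the path in row \<open>one\<close> has
      distinct ends; more are taken only once row \<open>one\<close> is used up.\<close>
    define i where "i = (if l \<le> card M + 2 then 2 else l - card M)"
    have i: "2 \<le> i" "i \<le> length p" "i + 2 \<le> l" "l \<le> i + card M"
      using False l cV p(4) \<open>length p < card M\<close> unfolding i_def by (auto split: if_splits)
    define q where "q = take i p"
    have q: "q \<noteq> []" "distinct q" "length q = i" "set q \<subseteq> M - J" "successively r q"
    proof -
      show "q \<noteq> []" "distinct q" "length q = i" using i p unfolding q_def by auto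
      show "set q \<subseteq> M - J" using set_take_subset p(2) unfolding q_def by metis
      show "successively r q"
        using p(3) successively_append_iff[of r "take i p" "drop i p"] unfolding q_def by simp
    qed
    have hl: "hd q \<in> M - J" "last q \<in> M - J" "hd q \<noteq> last q"
      using q i by (auto simp: subset_iff) (metis distinct.simps(2) hd_Cons_tl last_ConsL last_ConsR
        last_in_set length_Cons list.size(3) not_numeral_le_zero numeral_le_one_iff One_nat_def
        semiring_norm(69))
    have "path_between adj ({zero} \<times> (M - J)) (zero, hd q) (zero, last q) i"
      using q by (intro path_betweenI[of "map (Pair zero) q"])
        (auto simp: distinct_map inj_on_def successively_map hd_map last_map
          intro: successively_mono adj_col)
    moreover have "path_between adj ({one} \<times> M) (one, last q) (one, hd q) (l - i)"
      by (rule path_between_clique)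
        (use finite_M clique hl i in \<open>auto simp: card_cartesian_product\<close>)
    ultimately have "path_between adj ({zero} \<times> (M - J) \<union> {one} \<times> M) (zero, hd q) (one, hd q) (i + (l - i))"
      using refl[OF hl(2)] one_neq_zero by (intro path_between_append) (auto intro: adj_col)
    then have "cycle_in adj ({zero} \<times> (M - J) \<union> {one} \<times> M) l"
      using i cycle_in_close[where A = adj] adj_col[OF refl[OF hl(1)]] by (metis add_leD1 le_add_diff_inverse)
    then show ?thesis by (rule cycle_in_mono) (use V in blast)
  qed
qed

end

section \<open>Finite commutative rings and their maximal ideals\<close>

locale finite_cring = cring R for R (structure) +
  assumes finite_carrier: "finite (carrier R)"
begin

definition max_ideals :: "'a set set" where
  "max_ideals = {N. maximalideal N R}"

lemma finite_max_ideals: "finite max_ideals"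
proof (rule finite_subset)
  show "max_ideals \<subseteq> Pow (carrier R)"
    unfolding max_ideals_def
    using maximalideal.axioms(1) ideal.axioms(1) additive_subgroup.a_subset by blast
qed (simp add: finite_carrier)

section \<open>Arithmetic modulo a maximal ideal\<close>

context
  fixes N assumes N: "N \<in> max_ideals"
begin

lemma max_ideal_maximal: "maximalideal N R"
  using N max_ideals_def by simp

lemma max_ideal_ideal: "ideal N R"
  using max_ideal_maximal maximalideal.axioms(1) by blast

lemma max_ideal_prime: "primeideal N R"
  using max_ideal_maximal maximalideal_prime by blast

lemma max_ideal_carrier: "x \<in> N \<Longrightarrow> x \<in> carrier R"
  using max_ideal_ideal ideal.Icarr by metis

lemma max_ideal_zero: "\<zero> \<in> N"
  using max_ideal_ideal additive_subgroup.zero_closed ideal.axioms(1) by metis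

lemma max_ideal_add: "x \<in> N \<Longrightarrow> y \<in> N \<Longrightarrow> x \<oplus> y \<in> N"
  using max_ideal_ideal additive_subgroup.a_closed ideal.axioms(1) by metis

lemma max_ideal_uminus: "x \<in> N \<Longrightarrow> \<ominus> x \<in> N"
  using max_ideal_ideal additive_subgroup.a_inv_closed ideal.axioms(1) by metis

lemma max_ideal_minus: "x \<in> N \<Longrightarrow> y \<in> N \<Longrightarrow> x \<ominus> y \<in> N"
  unfolding a_minus_def using max_ideal_add max_ideal_uminus by blast

lemma max_ideal_mult: "x \<in> N \<Longrightarrow> y \<in> carrier R \<Longrightarrow> x \<otimes> y \<in> N"
  "x \<in> N \<Longrightarrow> y \<in> carrier R \<Longrightarrow> y \<otimes> x \<in> N"
  using max_ideal_ideal ideal.I_r_closed ideal.I_l_closed by metis+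

lemma max_ideal_one: "\<one> \<notin> N"
  using max_ideal_maximal maximalideal.I_notcarr ideal.one_imp_carrier max_ideal_ideal by metis

lemma max_ideal_dest: "x \<otimes> y \<in> N \<Longrightarrow> x \<in> carrier R \<Longrightarrow> y \<in> carrier R \<Longrightarrow> x \<in> N \<or> y \<in> N"
  using max_ideal_prime primeideal.I_prime by metis

lemma max_ideal_cong:
  assumes "x \<in> N" "y \<in> N" "a \<in> carrier R" "b \<in> carrier R" "\<one> \<ominus> a \<otimes> b \<in> N"
  shows "\<one> \<ominus> (a \<oplus> x) \<otimes> (b \<oplus> y) \<in> N"
proof -
  have c: "x \<in> carrier R" "y \<in> carrier R" using assms max_ideal_carrier by auto
  have "\<one> \<ominus> (a \<oplus> x) \<otimes> (b \<oplus> y) = (\<one> \<ominus> a \<otimes> b) \<ominus> (a \<otimes> y \<oplus> x \<otimes> (b \<oplus> y))"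
    using c assms(3,4) by algebra
  moreover have "a \<otimes> y \<in> N" "x \<otimes> (b \<oplus> y) \<in> N" using assms c max_ideal_mult by simp_all
  ultimately show ?thesis using assms(5) max_ideal_minus max_ideal_add by simp
qed

lemma max_ideal_inverse_notin:
  assumes "\<one> \<ominus> a \<otimes> b \<in> N" "a \<in> carrier R" "b \<in> carrier R"
  shows "a \<notin> N" "b \<notin> N"
proof -
  have "\<one> = (\<one> \<ominus> a \<otimes> b) \<oplus> a \<otimes> b" using assms by algebra
  then show "a \<notin> N" "b \<notin> N"
    using assms max_ideal_one max_ideal_add max_ideal_mult by metis+
qed

lemma max_ideal_inverse_unique:
  assumes "\<one> \<ominus> a \<otimes> b \<in> N" "\<one> \<ominus> a \<otimes> c \<in> N" "a \<in> carrier R" "b \<in> carrier R" "c \<in> carrier R"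
  shows "b \<ominus> c \<in> N"
proof -
  have "a \<otimes> (b \<ominus> c) = (\<one> \<ominus> a \<otimes> c) \<ominus> (\<one> \<ominus> a \<otimes> b)" using assms by algebra
  then have "a \<otimes> (b \<ominus> c) \<in> N" using max_ideal_minus assms by simp
  then show ?thesis
    using max_ideal_dest[of a "b \<ominus> c"] max_ideal_inverse_notin[OF assms(1,3,4)] assms by simp
qed

lemma max_ideal_minus_iff:
  assumes "x \<ominus> y \<in> N" "x \<in> carrier R" "y \<in> carrier R"
  shows "x \<in> N \<longleftrightarrow> y \<in> N"
proof -
  have "x = (x \<ominus> y) \<oplus> y" "y = x \<ominus> (x \<ominus> y)" using assms by algebra+
  then show ?thesis using max_ideal_add max_ideal_minus assms by metis
qed

lemma max_ideal_pow: "x [^] (n :: nat) \<in> N \<Longrightarrow> x \<in> carrier R \<Longrightarrow> x \<in> N"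
  by (induction n) (use max_ideal_one max_ideal_dest in \<open>auto simp: nat_pow_Suc\<close>)

end

text \<open>By finiteness there is a proper ideal with the largest number of elements, and it is
  maximal.\<close>

lemma ex_max_ideal:
  assumes "\<one> \<noteq> \<zero>"
  shows "max_ideals \<noteq> {}"
proof -
  define S where "S = {I. ideal I R \<and> I \<noteq> carrier R}"
  have "S \<subseteq> Pow (carrier R)"
    unfolding S_def using ideal.axioms(1) additive_subgroup.a_subset by blast
  then have finS: "finite S" using finite_carrier finite_subset by auto
  have "{\<zero>} \<in> S" unfolding S_def using zeroideal assms by auto
  then have "Max (card ` S) \<in> card ` S" using finS by (intro Max_in) auto
  then obtain I where "I \<in> S" "Max (card ` S) = card I" by blast
  then have I: "I \<in> S" "\<And>I'. I' \<in> S \<Longrightarrow> card I' \<le> card I"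
    using finS Max_ge[of "card ` S"] by auto
  have "maximalideal I R"
  proof (rule maximalidealI)
    fix I' assume I': "ideal I' R" "I \<subseteq> I'" "I' \<subseteq> carrier R"
    show "I' = I \<or> I' = carrier R"
    proof (rule disjCI)
      assume "I' \<noteq> carrier R"
      then have "card I' \<le> card I" using I I' S_def by simp
      moreover have "finite I'" using I'(3) finite_carrier finite_subset by blast
      ultimately show "I' = I" using I'(2) card_seteq by metis
    qed
  qed (use I(1) in \<open>auto simp: S_def\<close>)
  then show ?thesis unfolding max_ideals_def by blast
qed

text \<open>Two powers coincide by finiteness, so
  \<open>x [^] i \<otimes> (\<one> \<ominus> x [^] (j - i))\<close> is zero and lies in every
  maximal ideal, each of which is prime. A single exponent serves all of them.\<close>

lemma ex_unit_power:
  assumes x: "x \<in> carrier R"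
  shows "\<exists>n::nat. n \<ge> 1 \<and> (\<forall>N \<in> max_ideals. x \<in> N \<or> \<one> \<ominus> x [^] n \<in> N)"
proof -
  have "\<not> inj_on (\<lambda>n::nat. x [^] n) UNIV"
    using x finite_carrier by (metis finite_imageD finite_subset image_subsetI infinite_UNIV_nat nat_pow_closed)
  then obtain i j :: nat where ij: "i < j" "x [^] i = x [^] j"
    unfolding inj_on_def by (metis linorder_neqE_nat)
  have "x [^] i \<otimes> (\<one> \<ominus> x [^] (j - i)) = x [^] i \<ominus> x [^] i \<otimes> x [^] (j - i)"
    using x nat_pow_closed[of x i] nat_pow_closed[of x "j - i"] by algebra
  also have "x [^] i \<otimes> x [^] (j - i) = x [^] (i + (j - i))" using x nat_pow_mult by blast
  also have "i + (j - i) = j" using ij(1) by simp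
  finally have z: "x [^] i \<otimes> (\<one> \<ominus> x [^] (j - i)) = \<zero>" using ij x by (simp add: a_minus_def r_neg)
  have "x \<in> N \<or> \<one> \<ominus> x [^] (j - i) \<in> N" if "N \<in> max_ideals" for N
    using max_ideal_dest[OF that, of "x [^] i" "\<one> \<ominus> x [^] (j - i)"] z max_ideal_zero[OF that] x
      max_ideal_pow[OF that, of x i] by auto
  then show ?thesis using ij by (intro exI[of _ "j - i"]) auto
qed

text \<open>Some power of an element of \<open>N\<close> outside \<open>M\<close> is 1 modulo
  \<open>M\<close>.\<close>

lemma comaximal:
  assumes "M \<in> max_ideals" "N \<in> max_ideals" "M \<noteq> N"
  shows "\<exists>a \<in> N. \<one> \<ominus> a \<in> M"
proof -
  have "\<not> N \<subseteq> M"
  proof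
    assume "N \<subseteq> M"
    moreover have "M \<subseteq> carrier R" "M \<noteq> carrier R"
      using max_ideal_carrier[OF assms(1)] max_ideal_one[OF assms(1)] by auto
    ultimately show False
      using maximalideal.I_maximal[OF max_ideal_maximal[OF assms(2)] max_ideal_ideal[OF assms(1)]] assms(3)
      by blast
  qed
  then obtain x where x: "x \<in> N" "x \<notin> M" by blast
  have xc: "x \<in> carrier R" using max_ideal_carrier assms(2) x by blast
  obtain n :: nat where n: "n \<ge> 1" "\<one> \<ominus> x [^] n \<in> M"
    using ex_unit_power[OF xc] assms(1) x(2) by blast
  then obtain k where "n = Suc k" by (cases n) auto
  then have "x [^] n \<in> N" using x xc max_ideal_mult[OF assms(2)] by (simp add: nat_pow_Suc)
  then show ?thesis using n by blast
qed

text \<open>Multiply elements obtained from comaximality, one for each ideal of \<open>F\<close>. If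
  \<open>F\<close> consists of all maximal ideals but \<open>M\<close>, the product is idempotent
  modulo the Jacobson radical.\<close>

lemma ex_idempotent:
  assumes "M \<in> max_ideals" "finite F" "F \<subseteq> max_ideals" "M \<notin> F"
  shows "\<exists>e \<in> carrier R. \<one> \<ominus> e \<in> M \<and> (\<forall>N \<in> F. e \<in> N)"
  using assms(2-4)
proof (induction F rule: finite_induct)
  case empty
  then show ?case using max_ideal_zero[OF assms(1)] by (intro bexI[of _ \<one>]) (auto simp: a_minus_def r_neg)
next
  case (insert N F)
  then obtain e where e: "e \<in> carrier R" "\<one> \<ominus> e \<in> M" "\<forall>N \<in> F. e \<in> N" by auto
  obtain a where a: "a \<in> N" "\<one> \<ominus> a \<in> M" using comaximal[OF assms(1), of N] insert.prems by auto
  have ac: "a \<in> carrier R" using max_ideal_carrier a insert.prems by blast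
  have "\<one> \<ominus> e \<otimes> a = (\<one> \<ominus> e) \<oplus> e \<otimes> (\<one> \<ominus> a)" using e ac by algebra
  then have "\<one> \<ominus> e \<otimes> a \<in> M"
    using e a max_ideal_add[OF assms(1)] max_ideal_mult[OF assms(1)] by simp
  moreover have "e \<otimes> a \<in> N'" if "N' \<in> insert N F" for N'
  proof (cases "N' = N")
    case True
    then show ?thesis using max_ideal_mult(2)[of N a e] a e insert.prems by simp
  next
    case False
    then show ?thesis using max_ideal_mult(1)[of N' e a] that ac e insert.prems by auto
  qed
  ultimately show ?case using e(1) ac by (intro bexI[of _ "e \<otimes> a"]) auto
qed

section \<open>Inverses modulo the Jacobson radical\<close>

lemma jacobson_radical_iff: "x \<in> jacobson_radical R \<longleftrightarrow> x \<in> carrier R \<and> (\<forall>N \<in> max_ideals. x \<in> N)"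
  unfolding jacobson_radical_def max_ideals_def by auto

text \<open>\<open>z\<close> is the von Neumann regular inverse of \<open>x\<close> modulo the Jacobson radical.\<close>

definition pseudo_inverse :: "'a \<Rightarrow> 'a \<Rightarrow> bool" where
  "pseudo_inverse x z \<longleftrightarrow>
     z \<in> carrier R \<and> (\<forall>N \<in> max_ideals. (x \<in> N \<and> z \<in> N) \<or> \<one> \<ominus> x \<otimes> z \<in> N)"

text \<open>The candidate is \<open>x [^] (2 * n - 1)\<close> and not \<open>x [^] (n - 1)\<close>:
  its exponent is positive also for \<open>n = 1\<close>, so it lies in every maximal ideal that
  contains \<open>x\<close>.\<close>

lemma ex_pseudo_inverse:
  assumes x: "x \<in> carrier R"
  shows "\<exists>z. pseudo_inverse x z"
proof -
  obtain n :: nat where n: "n \<ge> 1" "\<forall>N \<in> max_ideals. x \<in> N \<or> \<one> \<ominus> x [^] n \<in> N"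
    using ex_unit_power[OF x] by blast
  obtain k where k: "2 * n - 1 = Suc k" using n by (cases "2 * n - 1") auto
  define z where "z = x [^] (2 * n - 1)"
  have zc: "z \<in> carrier R" using x z_def by simp
  have "x \<otimes> z = x [^] (2 * n)"
    using x n nat_pow_mult[of x 1 "2 * n - 1"] unfolding z_def by simp
  also have "\<dots> = x [^] n \<otimes> x [^] n" using x by (simp add: nat_pow_mult mult_2)
  finally have xz: "\<one> \<ominus> x \<otimes> z = (\<one> \<ominus> x [^] n) \<otimes> (\<one> \<oplus> x [^] n)"
    using x nat_pow_closed[of x n] by algebra
  have "(x \<in> N \<and> z \<in> N) \<or> \<one> \<ominus> x \<otimes> z \<in> N" if N: "N \<in> max_ideals" for N
  proof (cases "x \<in> N")
    case True
    then have "z \<in> N" unfolding z_def k using x max_ideal_mult[OF N] by (simp add: nat_pow_Suc)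
    then show ?thesis using True by blast
  next
    case False
    then have "\<one> \<ominus> x [^] n \<in> N" using n N by blast
    then show ?thesis unfolding xz using x max_ideal_mult(1)[OF N] by simp
  qed
  then show ?thesis unfolding pseudo_inverse_def using zc by blast
qed

lemma pseudo_inverse_sym: "pseudo_inverse x z \<Longrightarrow> x \<in> carrier R \<Longrightarrow> pseudo_inverse z x"
  unfolding pseudo_inverse_def using m_comm by metis

lemma pseudo_inverse_cong:
  assumes "pseudo_inverse x z" "x \<in> carrier R" "y \<in> carrier R" "x \<ominus> y \<in> jacobson_radical R"
  shows "pseudo_inverse y z"
proof -
  have zc: "z \<in> carrier R" using assms(1) pseudo_inverse_def by simp
  have "(y \<in> N \<and> z \<in> N) \<or> \<one> \<ominus> y \<otimes> z \<in> N" if N: "N \<in> max_ideals" for N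
  proof -
    have d: "x \<ominus> y \<in> N" using assms(4) N jacobson_radical_iff by blast
    have "\<one> \<ominus> y \<otimes> z = (\<one> \<ominus> x \<otimes> z) \<oplus> (x \<ominus> y) \<otimes> z" using assms zc by algebra
    then have "\<one> \<ominus> x \<otimes> z \<in> N \<Longrightarrow> \<one> \<ominus> y \<otimes> z \<in> N"
      using d zc max_ideal_add[OF N] max_ideal_mult[OF N] by simp
    then show ?thesis
      using assms(1) N max_ideal_minus_iff[OF N d assms(2,3)] unfolding pseudo_inverse_def by blast
  qed
  then show ?thesis unfolding pseudo_inverse_def using zc by blast
qed

lemma pseudo_inverse_unique:
  assumes "pseudo_inverse x z" "pseudo_inverse y z" "x \<in> carrier R" "y \<in> carrier R"
  shows "x \<ominus> y \<in> jacobson_radical R"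
proof -
  have zc: "z \<in> carrier R" using assms(1) pseudo_inverse_def by simp
  have "x \<ominus> y \<in> N" if N: "N \<in> max_ideals" for N
  proof -
    consider "x \<in> N" "z \<in> N" | "\<one> \<ominus> x \<otimes> z \<in> N" using assms(1) N pseudo_inverse_def by blast
    then show ?thesis
    proof cases
      case 1
      then have "\<one> \<ominus> y \<otimes> z \<notin> N" using max_ideal_inverse_notin(2)[OF N _ assms(4) zc] by metis
      then have "y \<in> N" using assms(2) N unfolding pseudo_inverse_def by metis
      then show ?thesis using 1 max_ideal_minus[OF N] by simp
    next
      case 2
      then have "z \<notin> N" using max_ideal_inverse_notin(2)[OF N _ assms(3) zc] by metis
      then have "\<one> \<ominus> y \<otimes> z \<in> N" using assms(2) N unfolding pseudo_inverse_def by metis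
      then have "\<one> \<ominus> z \<otimes> y \<in> N" "\<one> \<ominus> z \<otimes> x \<in> N"
        using 2 m_comm[OF assms(3) zc] m_comm[OF assms(4) zc] by simp_all
      then show ?thesis using max_ideal_inverse_unique[OF N] zc assms(3,4) by metis
    qed
  qed
  then show ?thesis using assms jacobson_radical_iff by simp
qed

lemma jacobson_radical_minus:
  "x \<in> jacobson_radical R \<Longrightarrow> y \<in> jacobson_radical R \<Longrightarrow> x \<ominus> y \<in> jacobson_radical R"
  using jacobson_radical_iff max_ideal_minus by simp

lemma jacobson_radical_minus_sym:
  assumes "x \<ominus> y \<in> jacobson_radical R" "x \<in> carrier R" "y \<in> carrier R"
  shows "y \<ominus> x \<in> jacobson_radical R"
proof -
  have "y \<ominus> x = \<zero> \<ominus> (x \<ominus> y)" using assms by algebra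
  then show ?thesis
    using jacobson_radical_minus[OF _ assms(1), of \<zero>] jacobson_radical_iff max_ideal_zero by simp
qed

lemma jacobson_radical_trans:
  assumes "x \<ominus> y \<in> jacobson_radical R" "z \<ominus> y \<in> jacobson_radical R"
    "x \<in> carrier R" "y \<in> carrier R" "z \<in> carrier R"
  shows "x \<ominus> z \<in> jacobson_radical R"
proof -
  have "x \<ominus> z = (x \<ominus> y) \<ominus> (z \<ominus> y)" using assms by algebra
  then show ?thesis using jacobson_radical_minus assms by simp
qed

text \<open>The condition on \<open>z\<close> depends only on the coset of \<open>x\<close> modulo
  the Jacobson radical, so the whole coset gets the same representative.\<close>

definition canonical :: "'a \<Rightarrow> 'a" where
  "canonical x = (SOME z. z \<in> carrier R \<and> x \<ominus> z \<in> jacobson_radical R)"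

text \<open>A pseudo-inverse is determined only modulo the Jacobson radical, and the first summand
  is constant on cosets. Adding the offset of \<open>x\<close> within its coset keeps the elements
  apart and makes the map injective.\<close>

definition pseudo_inv :: "'a \<Rightarrow> 'a" where
  "pseudo_inv x = (SOME z. pseudo_inverse x z) \<oplus> (x \<ominus> canonical x)"

lemma canonical:
  assumes "x \<in> carrier R"
  shows "canonical x \<in> carrier R" "x \<ominus> canonical x \<in> jacobson_radical R"
proof -
  have "x \<in> carrier R \<and> x \<ominus> x \<in> jacobson_radical R"
    using assms jacobson_radical_iff max_ideal_zero by (simp add: a_minus_def r_neg)
  then have "canonical x \<in> carrier R \<and> x \<ominus> canonical x \<in> jacobson_radical R"
    unfolding canonical_def by (rule someI)
  then show "canonical x \<in> carrier R" "x \<ominus> canonical x \<in> jacobson_radical R" by auto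
qed

lemma canonical_eq:
  assumes "x \<in> carrier R" "y \<in> carrier R" "x \<ominus> y \<in> jacobson_radical R"
  shows "canonical x = canonical y"
proof -
  have "x \<ominus> z \<in> jacobson_radical R \<longleftrightarrow> y \<ominus> z \<in> jacobson_radical R" if "z \<in> carrier R" for z
    using assms that jacobson_radical_trans jacobson_radical_minus_sym by metis
  then show ?thesis unfolding canonical_def by metis
qed

lemma some_pseudo_inverse:
  assumes "x \<in> carrier R"
  shows "pseudo_inverse x (SOME z. pseudo_inverse x z)"
  using ex_pseudo_inverse[OF assms] by (rule someI_ex)

lemma pseudo_inverse_pseudo_inv:
  assumes x: "x \<in> carrier R"
  shows "pseudo_inverse x (pseudo_inv x)"
proof -
  define s where "s = (SOME z. pseudo_inverse x z)"
  have s: "pseudo_inverse x s" "s \<in> carrier R"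
    using some_pseudo_inverse[OF x] s_def pseudo_inverse_def by auto
  have c: "canonical x \<in> carrier R" "x \<ominus> canonical x \<in> jacobson_radical R" using canonical x by auto
  have "(s \<oplus> (x \<ominus> canonical x)) \<ominus> s = x \<ominus> canonical x" using s x c by algebra
  then have "(s \<oplus> (x \<ominus> canonical x)) \<ominus> s \<in> jacobson_radical R" using c by simp
  then have "s \<ominus> (s \<oplus> (x \<ominus> canonical x)) \<in> jacobson_radical R"
    using jacobson_radical_minus_sym s x c by simp
  then have "pseudo_inverse (s \<oplus> (x \<ominus> canonical x)) x"
    using pseudo_inverse_cong[OF pseudo_inverse_sym[OF s(1) x] s(2)] s x c by simp
  then show ?thesis
    unfolding pseudo_inv_def s_def[symmetric] using pseudo_inverse_sym s x c by simp
qed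

lemma pseudo_inv_inj: "inj_on pseudo_inv (carrier R)"
proof (rule inj_onI)
  fix x y assume xy: "x \<in> carrier R" "y \<in> carrier R" "pseudo_inv x = pseudo_inv y"
  have d: "x \<ominus> y \<in> jacobson_radical R"
    using pseudo_inverse_unique pseudo_inverse_pseudo_inv xy by metis
  \<comment> \<open>Equality of the predicates makes the two choices by \<open>SOME\<close>
    coincide, so only the offsets could differ.\<close>
  then have "pseudo_inverse x = pseudo_inverse y"
    using pseudo_inverse_cong jacobson_radical_minus_sym xy by blast
  moreover define s where "s = (SOME z. pseudo_inverse x z)"
  moreover have "s \<in> carrier R"
    using some_pseudo_inverse[OF xy(1)] s_def pseudo_inverse_def by auto
  moreover have "canonical x = canonical y" using canonical_eq xy d by blast
  ultimately have e: "s \<oplus> (x \<ominus> canonical x) = s \<oplus> (y \<ominus> canonical x)"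
    using xy(3) unfolding pseudo_inv_def by simp
  have "x = (s \<oplus> (x \<ominus> canonical x)) \<ominus> s \<oplus> canonical x"
       "y = (s \<oplus> (y \<ominus> canonical x)) \<ominus> s \<oplus> canonical x"
    using xy(1,2) \<open>s \<in> carrier R\<close> canonical(1)[OF xy(1)] by algebra+
  then show "x = y" using e by simp
qed

text \<open>For such an \<open>x\<close> the predicates behind the two \<open>SOME\<close> terms
  coincide, so both return the same element, which cancels.\<close>

lemma pseudo_inv_fixed:
  assumes x: "x \<in> carrier R" "pseudo_inverse x x"
  shows "pseudo_inv x = x"
proof -
  have "pseudo_inverse x z \<longleftrightarrow> z \<in> carrier R \<and> x \<ominus> z \<in> jacobson_radical R" for z
  proof
    assume z: "pseudo_inverse x z"
    then have "z \<in> carrier R" using pseudo_inverse_def by simp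
    then show "z \<in> carrier R \<and> x \<ominus> z \<in> jacobson_radical R"
      using pseudo_inverse_unique[OF x(2) pseudo_inverse_sym[OF z x(1)]] x by simp
  next
    assume "z \<in> carrier R \<and> x \<ominus> z \<in> jacobson_radical R"
    then show "pseudo_inverse x z"
      using pseudo_inverse_cong[OF x(2,1)] pseudo_inverse_sym x by blast
  qed
  then have "(SOME z. pseudo_inverse x z) = canonical x" unfolding canonical_def by simp
  then show ?thesis
    unfolding pseudo_inv_def using x(1) canonical(1)[OF x(1)] by (simp add: a_minus_def a_lcomm r_neg)
qed

section \<open>Adjacency witnessed by a maximal ideal\<close>

definition joined :: "'a \<Rightarrow> 'a \<Rightarrow> bool" where
  "joined x y \<longleftrightarrow> (\<exists>N \<in> max_ideals. \<one> \<ominus> x \<otimes> y \<in> N)"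

lemma joined_sym: "joined x y \<Longrightarrow> x \<in> carrier R \<Longrightarrow> y \<in> carrier R \<Longrightarrow> joined y x"
  unfolding joined_def using m_comm by metis

lemma max_ideal_not_Units:
  assumes "N \<in> max_ideals" "x \<in> N"
  shows "x \<notin> Units R"
proof
  assume "x \<in> Units R"
  then have "inv x \<otimes> x = \<one>" "inv x \<in> carrier R" by (simp_all add: Units_l_inv)
  then show False using max_ideal_one max_ideal_mult(2) assms by metis
qed

lemma pancyclic_jacobson_graphI:
  assumes "\<And>l. 3 \<le> l \<Longrightarrow> l \<le> card (carrier R - jacobson_radical R) \<Longrightarrow>
             cycle_in joined (carrier R - jacobson_radical R) l"
  shows "pancyclic (with_proj (jacobson_graph R))"
proof (rule pancyclicI)
  let ?V = "carrier R - jacobson_radical R"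
  fix l assume "3 \<le> l" "l \<le> card (pverts (jacobson_graph R))"
  then have "cycle_in (\<lambda>x y. x \<in> ?V \<and> y \<in> ?V \<and> x \<noteq> y \<and> joined x y) ?V l"
    using assms by (intro cycle_in_irrefl) (auto simp: jacobson_graph_def)
  then show "cycle_in (\<lambda>x y. (x, y) \<in> parcs (jacobson_graph R)) (pverts (jacobson_graph R)) l"
    by (rule cycle_in_image[where f = id, simplified])
      (use max_ideal_not_Units in \<open>auto simp: jacobson_graph_def joined_def\<close>)
qed

text \<open>Elements outside a common maximal ideal are all 1 modulo it, hence joined. Enlarging
  \<open>F\<close> by \<open>N\<close> adds only elements outside \<open>N\<close>; they form a
  clique, which has to be linked to the end of the path built so far.\<close>

lemma hamiltonian_path_if_residue_fields_Z2:
  assumes res: "\<And>N y. N \<in> max_ideals \<Longrightarrow> y \<in> carrier R \<Longrightarrow> y \<in> N \<or> \<one> \<ominus> y \<in> N"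
    and "finite F" "F \<subseteq> max_ideals"
  shows "\<exists>p. distinct p \<and> successively joined p \<and>
           set p = {x \<in> carrier R. x \<notin> jacobson_radical R \<and> (\<forall>N \<in> max_ideals - F. x \<in> N)}"
  using assms(2,3)
proof (induction F rule: finite_induct)
  case empty
  then show ?case by (intro exI[of _ "[]"]) (auto simp: jacobson_radical_iff)
next
  case (insert N F)
  have N: "N \<in> max_ideals" using insert by simp
  have join: "joined x y" if "x \<in> carrier R" "y \<in> carrier R" "x \<notin> N'" "y \<notin> N'" "N' \<in> max_ideals" for x y N'
  proof -
    have "\<one> \<ominus> x \<in> N'" "\<one> \<ominus> y \<in> N'" using that res by blast+
    moreover have "\<one> \<ominus> x \<otimes> y = (\<one> \<ominus> x) \<oplus> x \<otimes> (\<one> \<ominus> y)" using that by algebra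
    ultimately have "\<one> \<ominus> x \<otimes> y \<in> N'"
      using max_ideal_add[OF that(5)] max_ideal_mult(2)[OF that(5) _ that(1)] by simp
    then show ?thesis unfolding joined_def using that(5) by blast
  qed
  define T where "T = {x \<in> carrier R. x \<notin> jacobson_radical R \<and> (\<forall>N \<in> max_ideals - F. x \<in> N)}"
  define C where "C = {x \<in> carrier R. x \<notin> N \<and> (\<forall>N' \<in> max_ideals - insert N F. x \<in> N')}"
  obtain p where p: "distinct p" "successively joined p" "set p = T"
    using insert unfolding T_def by auto
  have TN: "x \<in> N" if "x \<in> T" for x using that N insert.hyps(2) unfolding T_def by blast
  have split: "{x \<in> carrier R. x \<notin> jacobson_radical R \<and> (\<forall>N' \<in> max_ideals - insert N F. x \<in> N')} = T \<union> C"
    using N insert.hyps(2) unfolding T_def C_def jacobson_radical_iff by auto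
  have finC: "finite C" unfolding C_def using finite_carrier by simp
  have clique: "joined x y" if "x \<in> C" "y \<in> C" for x y
    using that join[of x y N] N unfolding C_def by blast
  show ?case
  proof (cases "p = []")
    case True
    obtain q where q: "set q = C" "distinct q" using finite_distinct_list[OF finC] by blast
    have "successively joined q" by (rule clique_successively) (use q clique in auto)
    then show ?thesis unfolding split using q p True by (intro exI[of _ q]) auto
  next
    case False
    define x where "x = last p"
    have x: "x \<in> T" using False p x_def by auto
    \<comment> \<open>\<open>x \<oplus> e\<close> agrees with \<open>x\<close> at all maximal ideals
      but \<open>N\<close>, where it is 1: it belongs to the new clique and is joined to
      \<open>x\<close> at any maximal ideal that avoids \<open>x\<close>.\<close>
    obtain e where e: "e \<in> carrier R" "\<one> \<ominus> e \<in> N" "\<forall>N' \<in> max_ideals - {N}. e \<in> N'"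
      using ex_idempotent[OF N, of "max_ideals - {N}"] finite_max_ideals by auto
    have eN: "e \<notin> N" using max_ideal_inverse_notin(2)[OF N, of \<one> e] e by simp
    have xc: "x \<in> carrier R" using x T_def by simp
    have mem: "x \<oplus> e \<in> N' \<longleftrightarrow> x \<in> N'" if "N' \<in> max_ideals" "e \<in> N'" for N'
    proof -
      have "x \<oplus> e \<ominus> x = e" using xc e by algebra
      then show ?thesis using max_ideal_minus_iff[OF that(1), of "x \<oplus> e" x] xc e that by simp
    qed
    have "x \<oplus> e \<ominus> e = x" using xc e by algebra
    then have "x \<oplus> e \<notin> N" using max_ideal_minus_iff[OF N, of "x \<oplus> e" e] xc e(1) TN[OF x] eN by simp
    moreover have "x \<in> N'" if "N' \<in> max_ideals - insert N F" for N' using x that unfolding T_def by auto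
    ultimately have c: "x \<oplus> e \<in> C" using mem e xc unfolding C_def by auto
    obtain N' where N': "N' \<in> max_ideals" "x \<notin> N'" using x jacobson_radical_iff T_def by auto
    then have "N' \<noteq> N" using TN x by blast
    then have jx: "joined x (x \<oplus> e)" using join[of x "x \<oplus> e" N'] mem[of N'] N' xc e by auto
    obtain q where q: "set q = C - {x \<oplus> e}" "distinct q"
      using finite_distinct_list[of "C - {x \<oplus> e}"] finC by auto
    have "successively joined ((x \<oplus> e) # q)"
      by (rule clique_successively) (use q clique c in auto)
    then have "successively joined (p @ (x \<oplus> e) # q)"
      using p(2) jx x_def by (simp add: successively_append_iff)
    moreover have "T \<inter> C = {}" using TN C_def by blast
    ultimately show ?thesis
      unfolding split using p q c by (intro exI[of _ "p @ (x \<oplus> e) # q"]) auto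
  qed
qed

end

section \<open>The ring with two elements\<close>

lemma ZFact_2:
  shows "carrier (ZFact 2) = {\<zero>\<^bsub>ZFact 2\<^esub>, \<one>\<^bsub>ZFact 2\<^esub>}" and "\<one>\<^bsub>ZFact 2\<^esub> \<noteq> \<zero>\<^bsub>ZFact 2\<^esub>"
    and "\<one>\<^bsub>ZFact 2\<^esub> \<oplus>\<^bsub>ZFact 2\<^esub> \<one>\<^bsub>ZFact 2\<^esub> = \<zero>\<^bsub>ZFact 2\<^esub>"
proof -
  define I where "I = Idl\<^bsub>\<Z>\<^esub> {2}"
  define h where "h = (\<lambda>a. I +>\<^bsub>\<Z>\<^esub> a)"
  have I: "ideal I \<Z>" unfolding I_def by (simp add: int.genideal_ideal)
  have Z: "ZFact 2 = \<Z> Quot I" unfolding ZFact_def I_def by simp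
  have hom: "h \<in> ring_hom \<Z> (ZFact 2)"
    unfolding Z h_def using ideal.rcos_ring_hom[OF I] .
  have eq: "h a = h b \<longleftrightarrow> even (a - b)" for a b
  proof -
    have "h a = h b \<longleftrightarrow> a - b \<in> I"
      unfolding h_def using int.quotient_eq_iff_same_a_r_cos[OF I, of a b] by simp
    moreover have "a - b \<in> I \<longleftrightarrow> 2 dvd (a - b)"
      unfolding I_def int_Idl dvd_def by (simp add: mult.commute)
    ultimately show ?thesis by blast
  qed
  interpret Z: cring "ZFact 2" by (rule ZFact_is_cring)
  have h1: "h 1 = \<one>\<^bsub>ZFact 2\<^esub>" using ring_hom_one[OF hom] by simp
  have h0: "h 0 = \<zero>\<^bsub>ZFact 2\<^esub>"
    using ring_hom_zero[OF hom int.ring_axioms Z.ring_axioms] by simp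
  have "carrier (ZFact 2) = range h"
    unfolding Z FactRing_def A_RCOSETS_def' h_def by auto
  moreover have "h a = h 0 \<or> h a = h 1" for a unfolding eq by simp
  ultimately show "carrier (ZFact 2) = {\<zero>\<^bsub>ZFact 2\<^esub>, \<one>\<^bsub>ZFact 2\<^esub>}"
    using h0 h1 by auto
  show "\<one>\<^bsub>ZFact 2\<^esub> \<noteq> \<zero>\<^bsub>ZFact 2\<^esub>" unfolding h0[symmetric] h1[symmetric] eq by simp
  have "h (1 + 1) = h 1 \<oplus>\<^bsub>ZFact 2\<^esub> h 1" using ring_hom_add[OF hom, of 1 1] by simp
  moreover have "h (1 + 1) = h 0" unfolding eq by simp
  ultimately show "\<one>\<^bsub>ZFact 2\<^esub> \<oplus>\<^bsub>ZFact 2\<^esub> \<one>\<^bsub>ZFact 2\<^esub> = \<zero>\<^bsub>ZFact 2\<^esub>" using h0 h1 by simp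
qed

section \<open>The ring in coordinates with respect to a chosen maximal ideal\<close>

locale chosen_max_ideal = finite_cring +
  fixes M
  assumes M: "M \<in> max_ideals" and other: "\<exists>N \<in> max_ideals. N \<noteq> M"
begin

abbreviation J where "J \<equiv> jacobson_radical R"

text \<open>Modulo the Jacobson radical, \<open>e\<close> and \<open>g\<close> are the complementary
  idempotents that split off the residue field of \<open>M\<close>.\<close>

definition e where
  "e = (SOME e. e \<in> carrier R \<and> \<one> \<ominus> e \<in> M \<and> (\<forall>N \<in> max_ideals - {M}. e \<in> N))"

definition g where "g = \<one> \<ominus> e"

lemma e: "e \<in> carrier R" "\<one> \<ominus> e \<in> M" "\<And>N. N \<in> max_ideals \<Longrightarrow> N \<noteq> M \<Longrightarrow> e \<in> N"
proof -
  have "\<exists>e. e \<in> carrier R \<and> \<one> \<ominus> e \<in> M \<and> (\<forall>N \<in> max_ideals - {M}. e \<in> N)"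
    using ex_idempotent[OF M, of "max_ideals - {M}"] finite_max_ideals by auto
  from someI_ex[OF this]
  show "e \<in> carrier R" "\<one> \<ominus> e \<in> M" "\<And>N. N \<in> max_ideals \<Longrightarrow> N \<noteq> M \<Longrightarrow> e \<in> N"
    unfolding e_def by auto
qed

lemma g: "g \<in> carrier R" "g \<in> M" "\<And>N. N \<in> max_ideals \<Longrightarrow> N \<noteq> M \<Longrightarrow> \<one> \<ominus> g \<in> N"
proof -
  have "\<one> \<ominus> (\<one> \<ominus> e) = e" using e(1) by algebra
  then show "g \<in> carrier R" "g \<in> M" "\<And>N. N \<in> max_ideals \<Longrightarrow> N \<noteq> M \<Longrightarrow> \<one> \<ominus> g \<in> N"
    using e unfolding g_def by auto
qed

lemma g_notin: "N \<in> max_ideals \<Longrightarrow> N \<noteq> M \<Longrightarrow> g \<notin> N"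
  using max_ideal_inverse_notin(2)[of N \<one> g] g by simp

lemma g_notin_J: "g \<notin> J"
  using other g_notin jacobson_radical_iff by blast

lemma J_subset: "J \<subseteq> M"
  using M jacobson_radical_iff by blast

lemma zero_J: "\<zero> \<in> J"
  using jacobson_radical_iff max_ideal_zero by simp

lemma M_subset: "M \<subseteq> carrier R"
  using max_ideal_carrier[OF M] by blast

lemma finite_M': "finite M"
  using M_subset finite_carrier finite_subset by blast

text \<open>The representative is taken inside all other maximal ideals, so that
  \<open>y \<oplus> m\<close> with \<open>y\<close> a row reduces to \<open>m\<close> there. As the
  condition on \<open>z\<close> depends only on \<open>x\<close> modulo \<open>M\<close>, congruent
  elements get the same representative.\<close>

definition row :: "'a \<Rightarrow> 'a" where
  "row x = (SOME z. z \<in> carrier R \<and> x \<ominus> z \<in> M \<and> (\<forall>N \<in> max_ideals - {M}. z \<in> N))"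

lemma row:
  assumes x: "x \<in> carrier R"
  shows "row x \<in> carrier R" "x \<ominus> row x \<in> M" "\<And>N. N \<in> max_ideals \<Longrightarrow> N \<noteq> M \<Longrightarrow> row x \<in> N"
proof -
  have "x \<ominus> e \<otimes> x = (\<one> \<ominus> e) \<otimes> x" using x e by algebra
  then have "x \<ominus> e \<otimes> x \<in> M" using e(2) x max_ideal_mult[OF M] by simp
  then have "\<exists>z. z \<in> carrier R \<and> x \<ominus> z \<in> M \<and> (\<forall>N \<in> max_ideals - {M}. z \<in> N)"
    using e x max_ideal_mult(1) by (intro exI[of _ "e \<otimes> x"]) auto
  from someI_ex[OF this]
  show "row x \<in> carrier R" "x \<ominus> row x \<in> M" "\<And>N. N \<in> max_ideals \<Longrightarrow> N \<noteq> M \<Longrightarrow> row x \<in> N"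
    unfolding row_def by auto
qed

lemma row_eq_iff:
  assumes "x \<in> carrier R" "y \<in> carrier R"
  shows "row x = row y \<longleftrightarrow> x \<ominus> y \<in> M"
proof
  assume xy: "x \<ominus> y \<in> M"
  have "x \<ominus> z \<in> M \<longleftrightarrow> y \<ominus> z \<in> M" if z: "z \<in> carrier R" for z
  proof -
    have "(x \<ominus> z) \<ominus> (y \<ominus> z) = x \<ominus> y" using assms z by algebra
    then show ?thesis using max_ideal_minus_iff[OF M, of "x \<ominus> z" "y \<ominus> z"] xy assms z by simp
  qed
  then show "row x = row y" unfolding row_def by metis
next
  assume eq: "row x = row y"
  have "x \<ominus> y = (x \<ominus> row x) \<ominus> (y \<ominus> row x)" using assms row(1) by algebra
  then show "x \<ominus> y \<in> M" using row(2)[OF assms(1)] row(2)[OF assms(2)] max_ideal_minus[OF M] eq by simp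
qed

definition K where "K = row ` carrier R"

lemma row_K: "y \<in> K \<Longrightarrow> row y = y"
  using row_eq_iff row max_ideal_minus_iff unfolding K_def
  by (metis (no_types, lifting) image_iff)

lemma K_carrier: "y \<in> K \<Longrightarrow> y \<in> carrier R"
  using row(1) unfolding K_def by blast

lemma row_in_K: "x \<in> carrier R \<Longrightarrow> row x \<in> K"
  unfolding K_def by blast

lemma K_other: "y \<in> K \<Longrightarrow> N \<in> max_ideals \<Longrightarrow> N \<noteq> M \<Longrightarrow> y \<in> N"
  using row(3) unfolding K_def by blast

lemma K_nonzero_iff:
  assumes "y \<in> K"
  shows "y \<noteq> row \<zero> \<longleftrightarrow> y \<notin> M"
proof -
  have "y \<ominus> \<zero> = y" using K_carrier[OF assms] by algebra
  then show ?thesis using row_eq_iff[of y \<zero>] row_K[OF assms] K_carrier[OF assms] by simp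
qed

lemma inverse_cong_iff:
  assumes "a \<in> carrier R" "b \<in> carrier R" "c \<in> carrier R" "d \<in> carrier R" "a \<ominus> c \<in> M" "b \<ominus> d \<in> M"
  shows "\<one> \<ominus> a \<otimes> b \<in> M \<longleftrightarrow> \<one> \<ominus> c \<otimes> d \<in> M"
proof -
  have "(\<one> \<ominus> c \<otimes> d) \<ominus> (\<one> \<ominus> a \<otimes> b) = (a \<ominus> c) \<otimes> b \<oplus> c \<otimes> (b \<ominus> d)" using assms by algebra
  moreover have "(a \<ominus> c) \<otimes> b \<oplus> c \<otimes> (b \<ominus> d) \<in> M"
    using assms max_ideal_add[OF M] max_ideal_mult[OF M] by simp
  ultimately show ?thesis
    using max_ideal_minus_iff[OF M, of "\<one> \<ominus> c \<otimes> d" "\<one> \<ominus> a \<otimes> b"] assms by simp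
qed

definition recip :: "'a \<Rightarrow> 'a" where
  "recip y = (SOME z. z \<in> K \<and> \<one> \<ominus> y \<otimes> z \<in> M)"

lemma recip:
  assumes y: "y \<in> carrier R" "y \<notin> M"
  shows "recip y \<in> K" "\<one> \<ominus> y \<otimes> recip y \<in> M"
proof -
  obtain z where z: "pseudo_inverse y z" using ex_pseudo_inverse y by blast
  then have zM: "z \<in> carrier R" "\<one> \<ominus> y \<otimes> z \<in> M" using M y unfolding pseudo_inverse_def by auto
  have "y \<ominus> y = \<zero>" using y by algebra
  then have "y \<ominus> y \<in> M" using max_ideal_zero[OF M] by simp
  then have "\<one> \<ominus> y \<otimes> row z \<in> M"
    using inverse_cong_iff[of y z y "row z"] y(1) zM row[OF zM(1)] by blast
  then have "\<exists>z. z \<in> K \<and> \<one> \<ominus> y \<otimes> z \<in> M" using row_in_K zM by blast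
  from someI_ex[OF this] show "recip y \<in> K" "\<one> \<ominus> y \<otimes> recip y \<in> M"
    unfolding recip_def by auto
qed

text \<open>Inverses modulo \<open>M\<close> are unique modulo \<open>M\<close>, and
  \<open>K\<close> contains each residue class once.\<close>

lemma recip_eqI:
  assumes "y \<in> carrier R" "z \<in> K" "\<one> \<ominus> y \<otimes> z \<in> M"
  shows "recip y = z"
proof -
  have zc: "z \<in> carrier R" using K_carrier assms by blast
  have "y \<notin> M" using max_ideal_inverse_notin(1)[OF M assms(3,1) zc] .
  note r = recip[OF assms(1) this]
  have "recip y \<ominus> z \<in> M"
    using max_ideal_inverse_unique[OF M r(2) assms(3,1) K_carrier[OF r(1)] zc] .
  then show ?thesis using row_eq_iff row_K r(1) assms(2) K_carrier by metis
qed

definition nbr :: "'a \<Rightarrow> 'a \<Rightarrow> bool" where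
  "nbr m n \<longleftrightarrow> m \<in> M \<and> n \<in> M \<and> joined m n"

sublocale coords: two_coordinates K "row \<zero>" "row \<one>" recip M J nbr
proof
  have Kz: "y \<in> carrier R" "y \<notin> M" "recip y \<in> K" "\<one> \<ominus> y \<otimes> recip y \<in> M"
    if "y \<in> K - {row \<zero>}" for y
    using that K_nonzero_iff K_carrier recip by auto
  show "finite K" unfolding K_def using finite_carrier by simp
  show "finite M" by (rule finite_M')
  show "row \<zero> \<in> K" "row \<one> \<in> K" by (simp_all add: row_in_K)
  have "\<one> \<ominus> \<zero> = \<one>" by algebra
  then show "row \<one> \<noteq> row \<zero>" using row_eq_iff[of \<one> \<zero>] max_ideal_one[OF M] by simp
  show "J \<subseteq> M" by (rule J_subset)
  show "J \<noteq> {}" using zero_J by blast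
  show "recip y \<in> K - {row \<zero>}" if y: "y \<in> K - {row \<zero>}" for y
    using Kz[OF y] max_ideal_inverse_notin(2)[OF M, of y "recip y"] K_nonzero_iff[of "recip y"]
      K_carrier by auto
  show "recip (recip y) = y" if y: "y \<in> K - {row \<zero>}" for y
    using Kz[OF y] m_comm[of y "recip y"] K_carrier y by (intro recip_eqI) auto
  have "\<one> \<ominus> \<one> \<otimes> \<one> = \<zero>" by algebra
  then have "\<one> \<ominus> \<one> \<otimes> \<one> \<in> M" using max_ideal_zero[OF M] by (simp only:)
  then have "\<one> \<ominus> row \<one> \<otimes> row \<one> \<in> M"
    using inverse_cong_iff[of \<one> \<one> "row \<one>" "row \<one>"] row[of \<one>] by blast
  then show "recip (row \<one>) = row \<one>" using row_in_K row(1) by (intro recip_eqI) auto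
  show "nbr n m" if "nbr m n" for m n
    using that joined_sym[of m n] max_ideal_carrier[OF M] unfolding nbr_def by simp
qed

text \<open>The witness cannot be \<open>M\<close> itself, as an element of \<open>M\<close> has no
  inverse modulo \<open>M\<close>.\<close>

lemma joined_nbr_cases:
  assumes "nbr m n"
  shows "\<exists>N \<in> max_ideals. N \<noteq> M \<and> \<one> \<ominus> m \<otimes> n \<in> N"
proof -
  obtain N where N: "N \<in> max_ideals" "\<one> \<ominus> m \<otimes> n \<in> N" and m: "m \<in> M" "n \<in> M"
    using assms unfolding nbr_def joined_def by blast
  have "N \<noteq> M"
    using max_ideal_inverse_notin(1)[OF N] max_ideal_carrier[OF M] m by metis
  then show ?thesis using N by (intro bexI[of _ N]) simp_all
qed

text \<open>Row edges are witnessed by \<open>M\<close>, where the columns vanish; column edges by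
  another maximal ideal, where the rows vanish.\<close>

lemma joined_if_adj:
  assumes "p \<in> K \<times> M" "q \<in> K \<times> M" "coords.adj p q"
  shows "joined (fst p \<oplus> snd p) (fst q \<oplus> snd q)"
proof -
  obtain y m z n where pq: "p = (y, m)" "q = (z, n)" "y \<in> K" "z \<in> K" "m \<in> M" "n \<in> M"
    using assms by auto
  have c: "y \<in> carrier R" "z \<in> carrier R" "m \<in> carrier R" "n \<in> carrier R"
    using pq K_carrier max_ideal_carrier[OF M] by auto
  consider "y \<noteq> row \<zero>" "z = recip y" | "nbr m n"
    using assms(3) unfolding coords.adj_def pq by auto
  then show ?thesis
  proof cases
    case 1
    then have "\<one> \<ominus> y \<otimes> z \<in> M" using recip[of y] K_nonzero_iff[OF pq(3)] c by simp
    then have "\<one> \<ominus> (y \<oplus> m) \<otimes> (z \<oplus> n) \<in> M" using max_ideal_cong[OF M pq(5,6) c(1,2)] by simp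
    then show ?thesis unfolding joined_def pq using M by auto
  next
    case 2
    then obtain N where N: "N \<in> max_ideals" "N \<noteq> M" "\<one> \<ominus> m \<otimes> n \<in> N" using joined_nbr_cases by blast
    have "\<one> \<ominus> (m \<oplus> y) \<otimes> (n \<oplus> z) \<in> N"
      using max_ideal_cong[OF N(1) _ _ c(3,4) N(3)] K_other N pq by blast
    then show ?thesis
      unfolding joined_def pq using N(1) a_comm[OF c(1,3)] a_comm[OF c(2,4)] by auto
  qed
qed

text \<open>Each \<open>x\<close> is \<open>row x\<close> plus an element of \<open>M\<close>; the
  splitting is unique because \<open>row\<close> recovers \<open>y\<close> from
  \<open>y \<oplus> m\<close>.\<close>

lemma vertices_bij: "bij_betw (\<lambda>p. fst p \<oplus> snd p) coords.vertices (carrier R - J)"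
proof -
  have diff: "y \<oplus> m \<ominus> y = m" if "y \<in> carrier R" "m \<in> carrier R" for y m using that by algebra
  have MC: "\<And>m. m \<in> M \<Longrightarrow> m \<in> carrier R" using max_ideal_carrier[OF M] .
  have row_sum: "row (y \<oplus> m) = y" if "y \<in> K" "m \<in> M" for y m
    using row_eq_iff[of "y \<oplus> m" y] row_K diff[of y m] that K_carrier MC by simp
  have "inj_on (\<lambda>p. fst p \<oplus> snd p) (K \<times> M)"
  proof (rule inj_onI)
    fix p q assume pq: "p \<in> K \<times> M" "q \<in> K \<times> M" "fst p \<oplus> snd p = fst q \<oplus> snd q"
    have "fst p = fst q"
      using row_sum[of "fst p" "snd p"] row_sum[of "fst q" "snd q"] pq by (simp add: mem_Times_iff)
    moreover have "fst p \<oplus> snd p \<ominus> fst p = snd p" "fst q \<oplus> snd q \<ominus> fst q = snd q"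
      using diff pq(1,2) K_carrier MC by (simp_all add: mem_Times_iff)
    ultimately show "p = q" using pq(3) by (metis prod.expand)
  qed
  then have "inj_on (\<lambda>p. fst p \<oplus> snd p) coords.vertices"
    by (rule inj_on_subset) (auto simp: coords.vertices_def)
  moreover have "(\<lambda>p. fst p \<oplus> snd p) ` coords.vertices = carrier R - J"
  proof -
    \<comment> \<open>The representative of the zero class may differ from \<zero>, but it lies in
      every maximal ideal, so adding it does not affect membership in \<open>J\<close>.\<close>
    have zJ: "row \<zero> \<in> J"
      using jacobson_radical_iff row[of \<zero>] K_nonzero_iff[of "row \<zero>"] row_in_K[of \<zero>] by auto
    have zadd: "row \<zero> \<oplus> m \<in> J \<longleftrightarrow> m \<in> J" if m: "m \<in> carrier R" for m
    proof -
      have "m \<oplus> row \<zero> \<ominus> m = row \<zero>" using diff row(1) m by simp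
      then have "row \<zero> \<oplus> m \<in> N \<longleftrightarrow> m \<in> N" if "N \<in> max_ideals" for N
        using max_ideal_minus_iff[OF that, of "row \<zero> \<oplus> m" m] zJ jacobson_radical_iff that m row(1)[of \<zero>]
          a_comm[of "row \<zero>" m] by simp
      then show ?thesis using jacobson_radical_iff m row(1)[of \<zero>] by auto
    qed
    have in1: "y \<oplus> m \<in> carrier R - J" if "(y, m) \<in> coords.vertices" for y m
    proof (cases "y = row \<zero>")
      case True
      then show ?thesis using that zadd row(1)[of \<zero>] MC unfolding coords.vertices_def by auto
    next
      case False
      have ym: "y \<in> K" "m \<in> M" using that coords.vertices_def by auto
      have "y \<notin> M" using False K_nonzero_iff ym by simp
      moreover have "y \<oplus> m \<ominus> m = y" using ym K_carrier MC by algebra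
      ultimately have "y \<oplus> m \<notin> M" using max_ideal_minus[OF M, of "y \<oplus> m" m] ym by auto
      then show ?thesis using J_subset ym K_carrier MC by auto
    qed
    have in2: "x \<in> (\<lambda>p. fst p \<oplus> snd p) ` coords.vertices" if x: "x \<in> carrier R - J" for x
    proof -
      have xc: "x \<in> carrier R" using x by simp
      have eq: "row x \<oplus> (x \<ominus> row x) = x" using xc row(1)[OF xc] by algebra
      have "(row x, x \<ominus> row x) \<in> coords.vertices"
        using row[OF xc] row_in_K[OF xc] x zadd[of "x \<ominus> row x"] eq xc
        unfolding coords.vertices_def by auto
      then show ?thesis using eq by (metis (no_types, lifting) fst_conv snd_conv image_eqI)
    qed
    show ?thesis using in1 in2 by fastforce
  qed
  ultimately show ?thesis unfolding bij_betw_def by blast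
qed

lemma cycle_transfer:
  assumes "cycle_in coords.adj coords.vertices l"
  shows "cycle_in joined (carrier R - J) l"
  by (rule cycle_in_image[OF assms])
    (use vertices_bij joined_if_adj in \<open>auto simp: bij_betw_def coords.vertices_def\<close>)

lemma pancyclic_if_coords:
  assumes "\<And>l. 3 \<le> l \<Longrightarrow> l \<le> card coords.vertices \<Longrightarrow> cycle_in coords.adj coords.vertices l"
  shows "pancyclic (with_proj (jacobson_graph R))"
  using assms cycle_transfer bij_betw_same_card[OF vertices_bij]
  by (intro pancyclic_jacobson_graphI) auto

text \<open>The hypothesis forces \<open>J\<close> to be zero and \<open>M = {\<zero>, g}\<close>
  with \<open>g\<close> idempotent. Multiplication by \<open>g\<close> then yields the projection to
  the two-element ring, and reduction modulo \<open>M\<close> the projection to the field.\<close>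

lemma iso_Z2_times_field:
  assumes "M - J \<subseteq> {g}"
  shows "R \<simeq> RDirProd (ZFact 2) (R Quot M)"
proof -
  have I: "ideal M R" using max_ideal_ideal[OF M] .
  \<comment> \<open>Translating \<open>g\<close> by an element of \<open>J\<close> stays inside
    \<open>M - J\<close>, hence gives \<open>g\<close> again.\<close>
  have J0: "j = \<zero>" if j: "j \<in> J" for j
  proof -
    have jc: "j \<in> carrier R" using j jacobson_radical_iff by blast
    have gj: "g \<oplus> j \<ominus> g = j" "g \<oplus> j \<ominus> j = g" using jc g(1) by algebra+
    have "g \<oplus> j \<in> M" using max_ideal_add[OF M] g(2) j J_subset by blast
    moreover have "g \<oplus> j \<notin> J" using jacobson_radical_minus[of "g \<oplus> j" j] j gj(2) g_notin_J by auto
    ultimately have "g \<oplus> j = g" using assms by blast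
    then have "j = g \<ominus> g" using gj(1) by simp
    then show ?thesis using g(1) by (simp add: a_minus_def r_neg)
  qed
  have M0: "x = \<zero> \<or> x = g" if "x \<in> M" for x using that assms J0 by blast
  have g0: "g \<noteq> \<zero>" using g_notin_J zero_J by auto
  obtain N where N: "N \<in> max_ideals" "N \<noteq> M" using other by blast
  have gg: "g \<otimes> g = g"
  proof -
    have "g \<otimes> g \<noteq> \<zero>"
      using max_ideal_dest[OF N(1), of g g] g_notin[OF N] max_ideal_zero[OF N(1)] g(1) by auto
    then show ?thesis using M0[of "g \<otimes> g"] max_ideal_mult(1)[OF M g(2,1)] by blast
  qed
  have "g \<oplus> g \<ominus> g = g" using g(1) by algebra
  then have g2: "g \<oplus> g = \<zero>"
    using M0[of "g \<oplus> g"] max_ideal_add[OF M g(2,2)] g0 g(1) by (auto simp: a_minus_def r_neg)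
  have gx: "g \<otimes> x = \<zero> \<or> g \<otimes> x = g" if "x \<in> carrier R" for x
    using M0[of "g \<otimes> x"] max_ideal_mult(1)[OF M g(2) that] by blast
  define \<chi> where "\<chi> x = (if g \<otimes> x = \<zero> then \<zero>\<^bsub>ZFact 2\<^esub> else \<one>\<^bsub>ZFact 2\<^esub>)" for x
  interpret Z: cring "ZFact 2" by (rule ZFact_is_cring)
  have \<chi>: "\<chi> \<in> ring_hom R (ZFact 2)"
  proof (rule ring_hom_memI)
    fix x y assume xy: "x \<in> carrier R" "y \<in> carrier R"
    show "\<chi> x \<in> carrier (ZFact 2)" unfolding \<chi>_def by simp
    have gxy: "g \<otimes> (x \<otimes> y) = (g \<otimes> x) \<otimes> (g \<otimes> y)"
    proof -
      have "(g \<otimes> x) \<otimes> (g \<otimes> y) = (g \<otimes> g) \<otimes> (x \<otimes> y)" using g(1) xy by algebra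
      then show ?thesis using gg by simp
    qed
    from gx[OF xy(1)] gx[OF xy(2)] show "\<chi> (x \<otimes> y) = \<chi> x \<otimes>\<^bsub>ZFact 2\<^esub> \<chi> y"
      by (elim disjE) (simp_all add: \<chi>_def gxy gg g0 g(1))
    have gxy': "g \<otimes> (x \<oplus> y) = g \<otimes> x \<oplus> g \<otimes> y" using g(1) xy by algebra
    from gx[OF xy(1)] gx[OF xy(2)] show "\<chi> (x \<oplus> y) = \<chi> x \<oplus>\<^bsub>ZFact 2\<^esub> \<chi> y"
      by (elim disjE) (simp_all add: \<chi>_def gxy' g2 g0 g(1) ZFact_2(3))
  next
    show "\<chi> \<one> = \<one>\<^bsub>ZFact 2\<^esub>" unfolding \<chi>_def using g0 g(1) by simp
  qed
  define f where "f x = (\<chi> x, M +> x)" for x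
  have "f \<in> ring_hom R (RDirProd (ZFact 2) (R Quot M))"
    using \<chi> ideal.rcos_ring_hom[OF I] unfolding f_def ring_hom_def
    by (auto simp: RDirProd_def DirProd_def monoid.defs)
  moreover have "bij_betw f (carrier R) (carrier (RDirProd (ZFact 2) (R Quot M)))"
    unfolding bij_betw_def
  proof
    show "inj_on f (carrier R)"
    proof (rule inj_onI)
      fix x y assume xy: "x \<in> carrier R" "y \<in> carrier R" "f x = f y"
      then have d: "x \<ominus> y \<in> M" using quotient_eq_iff_same_a_r_cos[OF I, of x y] f_def by simp
      have "g \<otimes> x = g \<otimes> y"
        using xy(3) gx[OF xy(1)] gx[OF xy(2)] ZFact_2(2) unfolding f_def \<chi>_def by (auto split: if_splits)
      moreover have "g \<otimes> (x \<ominus> y) = g \<otimes> x \<ominus> g \<otimes> y" using xy g(1) by algebra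
      ultimately have "g \<otimes> (x \<ominus> y) = \<zero>" using xy g(1) by (simp add: a_minus_def r_neg)
      then have "x \<ominus> y = \<zero>" using M0[OF d] gg g0 by auto
      then show "x = y" using xy by simp
    qed
    have "p \<in> f ` carrier R" if p: "p \<in> carrier (RDirProd (ZFact 2) (R Quot M))" for p
    proof -
      obtain z C where zC: "p = (z, C)" "z \<in> carrier (ZFact 2)" "C \<in> carrier (R Quot M)"
        using p by (auto simp: RDirProd_carrier)
      then obtain x where x: "x \<in> carrier R" "C = M +> x"
        by (auto simp: FactRing_def A_RCOSETS_def')
      \<comment> \<open>Adding \<open>g\<close> keeps the class modulo \<open>M\<close> and switches
        the value of \<chi>, so \<open>x\<close> or \<open>x \<oplus> g\<close> is mapped to the
        given pair.\<close>
      have "x \<oplus> g \<ominus> x = g" using x g(1) by algebra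
      then have C2: "M +> (x \<oplus> g) = C"
        using quotient_eq_iff_same_a_r_cos[OF I, of "x \<oplus> g" x] x g by simp
      have "g \<otimes> (x \<oplus> g) = g \<otimes> x \<oplus> g" using x g(1) gg by (simp add: r_distr)
      moreover have "z = \<zero>\<^bsub>ZFact 2\<^esub> \<or> z = \<one>\<^bsub>ZFact 2\<^esub>" using zC(2) ZFact_2(1) by blast
      ultimately have "z = \<chi> x \<or> z = \<chi> (x \<oplus> g)"
        using gx[OF x(1)] by (elim disjE) (simp_all add: \<chi>_def g2 g0 g(1))
      then have "p = f x \<or> p = f (x \<oplus> g)" using zC(1) x(2) C2 f_def by auto
      then show ?thesis using x(1) g(1) by auto
    qed
    moreover have "f ` carrier R \<subseteq> carrier (RDirProd (ZFact 2) (R Quot M))"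
      using \<open>f \<in> ring_hom R _\<close> by (auto simp: ring_hom_def)
    ultimately show "f ` carrier R = carrier (RDirProd (ZFact 2) (R Quot M))" by blast
  qed
  ultimately show ?thesis unfolding is_ring_iso_def ring_iso_def by blast
qed

section \<open>Inverses of columns and of rows\<close>

lemma nbr_pseudo_inv:
  assumes m: "m \<in> M - J"
  shows "nbr m (pseudo_inv m)" "pseudo_inv m \<in> M - J"
proof -
  have mc: "m \<in> carrier R" using m M_subset by blast
  have p: "pseudo_inverse m (pseudo_inv m)" using pseudo_inverse_pseudo_inv[OF mc] .
  have pc: "pseudo_inv m \<in> carrier R" using p pseudo_inverse_def by simp
  have pM: "pseudo_inv m \<in> M"
    using p M m max_ideal_inverse_notin(1)[OF M _ mc pc] unfolding pseudo_inverse_def by blast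
  obtain N where N: "N \<in> max_ideals" "m \<notin> N" using m mc jacobson_radical_iff by blast
  then have 1: "\<one> \<ominus> m \<otimes> pseudo_inv m \<in> N" using p unfolding pseudo_inverse_def by blast
  then show "nbr m (pseudo_inv m)" unfolding nbr_def joined_def using N pM m by blast
  show "pseudo_inv m \<in> M - J"
    using max_ideal_inverse_notin(2)[OF N(1) 1 mc pc] N pM jacobson_radical_iff by blast
qed

text \<open>\<open>g\<close> is 0 modulo \<open>M\<close> and 1 modulo the other maximal ideals, so
  it is its own pseudo-inverse.\<close>

lemma pseudo_inv_g: "pseudo_inv g = g"
proof (rule pseudo_inv_fixed[OF g(1)])
  have "\<one> \<ominus> g \<otimes> g = (\<one> \<ominus> g) \<oplus> g \<otimes> (\<one> \<ominus> g)" using g(1) by algebra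
  then have "\<one> \<ominus> g \<otimes> g \<in> N" if "N \<in> max_ideals" "N \<noteq> M" for N
    using g(3)[OF that] g(1) max_ideal_add[OF that(1)] max_ideal_mult(2)[OF that(1)] that by metis
  then show "pseudo_inverse g g" unfolding pseudo_inverse_def using g(1,2) by metis
qed

lemma g_in: "g \<in> M - J" "nbr g g"
proof -
  show "g \<in> M - J" using g(2) g_notin_J by simp
  then show "nbr g g" using nbr_pseudo_inv(1)[of g] pseudo_inv_g by simp
qed

lemma bij_pseudo_inv: "bij_betw pseudo_inv (M - J) (M - J)"
proof -
  have "inj_on pseudo_inv (M - J)"
    by (rule inj_on_subset[OF pseudo_inv_inj]) (use M_subset in blast)
  moreover have "pseudo_inv ` (M - J) \<subseteq> M - J" using nbr_pseudo_inv(2) by (rule image_subsetI)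
  moreover have "finite (M - J)" using finite_M' by simp
  ultimately show ?thesis unfolding bij_betw_def using endo_inj_surj by metis
qed

lemma recip_row_eq_iff:
  assumes "y \<in> carrier R" "y \<notin> M"
  shows "recip (row y) = row y \<longleftrightarrow> \<one> \<ominus> y \<otimes> y \<in> M"
proof -
  note r = row[OF assms(1)]
  have cong: "\<one> \<ominus> y \<otimes> y \<in> M \<longleftrightarrow> \<one> \<ominus> row y \<otimes> row y \<in> M"
    using inverse_cong_iff[of y y "row y" "row y"] assms(1) r by blast
  have "row y \<notin> M" using max_ideal_minus_iff[OF M r(2) assms(1) r(1)] assms(2) by blast
  then show ?thesis
    using cong recip[of "row y"] recip_eqI[of "row y" "row y"] row_in_K[OF assms(1)] r(1) by metis
qed

lemma row_square_one:
  assumes "y \<in> carrier R" "\<one> \<ominus> y \<otimes> y \<in> M"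
  shows "row y = row \<one> \<or> row y = row (\<ominus> \<one>)"
proof -
  have "\<one> \<ominus> y \<otimes> y = (y \<ominus> \<one>) \<otimes> (\<ominus> (y \<ominus> (\<ominus> \<one>)))" using assms(1) by algebra
  then have "y \<ominus> \<one> \<in> M \<or> \<ominus> (y \<ominus> (\<ominus> \<one>)) \<in> M"
    using max_ideal_dest[OF M, of "y \<ominus> \<one>" "\<ominus> (y \<ominus> (\<ominus> \<one>))"] assms by simp
  moreover have "\<ominus> (\<ominus> (y \<ominus> (\<ominus> \<one>))) = y \<ominus> (\<ominus> \<one>)" using assms(1) by algebra
  ultimately have "y \<ominus> \<one> \<in> M \<or> y \<ominus> (\<ominus> \<one>) \<in> M" using max_ideal_uminus[OF M] by metis
  then show ?thesis using row_eq_iff[OF assms(1)] by simp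
qed

lemma minus_one: "\<ominus> \<one> \<in> carrier R" "\<ominus> \<one> \<notin> M" "recip (row (\<ominus> \<one>)) = row (\<ominus> \<one>)"
proof -
  show c: "\<ominus> \<one> \<in> carrier R" by simp
  show n: "\<ominus> \<one> \<notin> M"
    using max_ideal_uminus[OF M, of "\<ominus> \<one>"] max_ideal_one[OF M] by auto
  have "\<one> \<ominus> (\<ominus> \<one>) \<otimes> (\<ominus> \<one>) = \<zero>" by algebra
  then have "\<one> \<ominus> (\<ominus> \<one>) \<otimes> (\<ominus> \<one>) \<in> M" using max_ideal_zero[OF M] by (simp only:)
  then show "recip (row (\<ominus> \<one>)) = row (\<ominus> \<one>)"
    using recip_row_eq_iff[OF c n] by blast
qed

lemma row_nonzero: "y \<in> carrier R \<Longrightarrow> y \<notin> M \<Longrightarrow> row y \<in> K - {row \<zero>}"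
  using K_nonzero_iff[of "row y"] row_in_K[of y] row(1,2)[of y] max_ideal_minus_iff[OF M, of y "row y"] by simp

lemma one_notin: "\<one> \<notin> M" using max_ideal_one[OF M] .

text \<open>The hypotheses on \<open>y\<close> say that the residue field of \<open>M\<close> has
  more than three elements. The self-inverse rows are those of 1 and -1, which coincide in
  characteristic 2.\<close>

lemma pancyclic_if_not_involutory:
  assumes d: "d \<in> M - J" "d \<noteq> g"
    and y: "y \<in> carrier R" "y \<notin> M" "\<one> \<ominus> y \<otimes> y \<notin> M"
  shows "pancyclic (with_proj (jacobson_graph R))"
proof (rule pancyclic_if_coords)
  fix l assume l: "3 \<le> l" "l \<le> card coords.vertices"
  show "cycle_in coords.adj coords.vertices l"
  proof (rule coords.cycles_if_not_involutory[OF g_in bij_pseudo_inv _ pseudo_inv_g d])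
    show "nbr m (pseudo_inv m)" if "m \<in> M - J" for m using nbr_pseudo_inv that by blast
    show "row (\<ominus> \<one>) \<in> K - {row \<zero>}" using row_nonzero minus_one by blast
    show "recip (row (\<ominus> \<one>)) = row (\<ominus> \<one>)" by (rule minus_one)
    show "z = row \<one> \<or> z = row (\<ominus> \<one>)" if z: "z \<in> K - {row \<zero>}" "recip z = z" for z
    proof -
      have zc: "z \<in> carrier R" "z \<notin> M" "row z = z" using z(1) K_carrier K_nonzero_iff row_K by auto
      then have "\<one> \<ominus> z \<otimes> z \<in> M" using recip_row_eq_iff[of z] z(2) by simp
      then show ?thesis using row_square_one[of z] zc by simp
    qed
    show "row y \<in> K - {row \<zero>}" using row_nonzero y by blast
    show "recip (row y) \<noteq> row y" using recip_row_eq_iff y by blast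
  qed (use l in auto)
qed

text \<open>Under \<open>inv\<close> an element is its own inverse at every maximal ideal that
  avoids it.\<close>

lemma nbr_refl:
  assumes inv: "\<And>N y. N \<in> max_ideals \<Longrightarrow> y \<in> carrier R \<Longrightarrow> y \<in> N \<or> \<one> \<ominus> y \<otimes> y \<in> N"
    and m: "m \<in> M - J"
  shows "nbr m m"
proof -
  obtain N where "N \<in> max_ideals" "m \<notin> N" using m M_subset jacobson_radical_iff by blast
  then show ?thesis using inv[of N m] m M_subset unfolding nbr_def joined_def by blast
qed

text \<open>Here the residue field of \<open>M\<close> has three elements, and it remains to choose
  \<open>h\<close> and \<open>E\<close> so that an odd number of columns of \<open>M - J\<close> is
  left for the zigzag.\<close>

lemma pancyclic_if_involutory_odd:
  assumes d: "d \<in> M - J" "d \<noteq> g"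
    and inv: "\<And>N y. N \<in> max_ideals \<Longrightarrow> y \<in> carrier R \<Longrightarrow> y \<in> N \<or> \<one> \<ominus> y \<otimes> y \<in> N"
    and two: "\<one> \<oplus> \<one> \<notin> M"
  shows "pancyclic (with_proj (jacobson_graph R))"
proof -
  have fin: "finite (M - J)" using finite_M' by simp
  have "\<exists>h \<in> M - J. \<exists>E. (E = [] \<or> (\<exists>d \<in> M - J - {h}. nbr h d \<and> E = [d])) \<and>
          odd (card (M - J - {h} - set E))"
  proof (cases "even (card (M - J))")
    case True
    have "card (M - J) \<noteq> 0" using d fin by auto
    then have "odd (card (M - J - {g}))" using True fin g_in by (simp add: card_Diff_singleton)
    then show ?thesis using g_in by (intro bexI[of _ g] exI[of _ "[]"]) auto
  next
    \<comment> \<open>If \<open>M - J\<close> has odd size, two columns have to be set aside, and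
      they must be related by \<open>nbr\<close>.\<close>
    case False
    have gm: "\<ominus> g \<in> M - J"
    proof -
      have "\<zero> \<ominus> (\<ominus> g) = g" using g(1) by algebra
      then have "\<ominus> g \<notin> J" using jacobson_radical_minus[OF zero_J, of "\<ominus> g"] g_notin_J by metis
      then show ?thesis using max_ideal_uminus[OF M g(2)] by simp
    qed
    \<comment> \<open>Otherwise \<open>M - J\<close> would be \<open>{g, \<ominus> g}\<close>, and
      \<open>d\<close> shows that these two elements differ, against the odd size.\<close>
    have "\<exists>x \<in> M - J. x \<noteq> g \<and> x \<noteq> \<ominus> g"
    proof (rule ccontr)
      assume n: "\<not> ?thesis"
      have "M - J = {g, \<ominus> g}"
      proof
        show "M - J \<subseteq> {g, \<ominus> g}" using n by blast
        show "{g, \<ominus> g} \<subseteq> M - J" using g_in(1) gm by simp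
      qed
      moreover have "g \<noteq> \<ominus> g" using n d by metis
      ultimately have "card (M - J) = 2" by simp
      then show False using False by simp
    qed
    then obtain x where x: "x \<in> M - J" "x \<noteq> g" "x \<noteq> \<ominus> g" by blast
    have xc: "x \<in> carrier R" using x M_subset by blast
    obtain N where N: "N \<in> max_ideals" "x \<notin> N" using x(1) xc jacobson_radical_iff[of x] by blast
    then have NM: "N \<noteq> M" using x(1) by auto
    have sq: "\<one> \<ominus> x \<otimes> x \<in> N" using inv[OF N(1) xc] N(2) by simp
    \<comment> \<open>Modulo \<open>N\<close> the element \<open>x\<close> is 1 or -1, the residues
      of \<open>g\<close> and \<open>\<ominus> g\<close> there; accordingly \<open>h\<close> is
      \<open>g\<close> or \<open>\<ominus> g\<close>.\<close>
    have "\<one> \<ominus> x \<otimes> x = (\<one> \<ominus> x) \<otimes> (\<one> \<oplus> x)" using xc by algebra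
    then consider "\<one> \<ominus> x \<in> N" | "\<one> \<oplus> x \<in> N"
      using max_ideal_dest[OF N(1), of "\<one> \<ominus> x" "\<one> \<oplus> x"] sq xc by auto
    then have "\<exists>h \<in> M - J. h \<noteq> x \<and> nbr h x"
    proof cases
      case 1
      have "\<one> \<ominus> g \<otimes> x = (\<one> \<ominus> x) \<oplus> x \<otimes> (\<one> \<ominus> g)" using xc g(1) by algebra
      then have "\<one> \<ominus> g \<otimes> x \<in> N"
        using 1 g(3)[OF N(1) NM] max_ideal_add[OF N(1)] max_ideal_mult(2)[OF N(1)] xc by simp
      then have "nbr g x" unfolding nbr_def joined_def using x(1) g(2) N(1) by auto
      then show ?thesis using x(2) g_in(1) by metis
    next
      case 2
      have "\<one> \<ominus> (\<ominus> g) \<otimes> x = (\<one> \<oplus> x) \<ominus> x \<otimes> (\<one> \<ominus> g)" using xc g(1) by algebra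
      then have "\<one> \<ominus> (\<ominus> g) \<otimes> x \<in> N"
        using 2 g(3)[OF N(1) NM] max_ideal_minus[OF N(1)] max_ideal_mult(2)[OF N(1)] xc by simp
      then have "nbr (\<ominus> g) x" unfolding nbr_def joined_def using x(1) gm N(1) by auto
      then show ?thesis using x(3) gm by metis
    qed
    then obtain h where h: "h \<in> M - J" "h \<noteq> x" "nbr h x" by blast
    have "card (M - J - {h} - {x}) = card (M - J) - 1 - 1"
      using h x fin by (simp add: card_Diff_singleton)
    moreover have "card (M - J) \<ge> 2"
      using card_mono[OF fin, of "{h, x}"] h x by auto
    ultimately have "odd (card (M - J - {h} - {x}))" using False by simp
    then show ?thesis using h x(1) by (intro bexI[OF _ h(1)] exI[of _ "[x]"]) simp
  qed
  then obtain h E where hE: "h \<in> M - J" "E = [] \<or> (\<exists>d \<in> M - J - {h}. nbr h d \<and> E = [d])"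
      "odd (card (M - J - {h} - set E))"
    by blast
  have K3: "K = {row \<zero>, row \<one>, row (\<ominus> \<one>)}"
  proof
    show "{row \<zero>, row \<one>, row (\<ominus> \<one>)} \<subseteq> K" using row_in_K by simp
    show "K \<subseteq> {row \<zero>, row \<one>, row (\<ominus> \<one>)}"
    proof
      fix y assume y: "y \<in> K"
      have yc: "y \<in> carrier R" "row y = y" using y K_carrier row_K by auto
      consider "y \<in> M" | "\<one> \<ominus> y \<otimes> y \<in> M" using inv[OF M yc(1)] by blast
      then show "y \<in> {row \<zero>, row \<one>, row (\<ominus> \<one>)}"
        using K_nonzero_iff[OF y] row_square_one[OF yc(1)] yc(2) by cases auto
    qed
  qed
  have "\<one> \<ominus> (\<ominus> \<one>) = \<one> \<oplus> \<one>" by algebra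
  then have ne: "row \<one> \<noteq> row (\<ominus> \<one>)" using row_eq_iff[of \<one> "\<ominus> \<one>"] two by simp
  show ?thesis
    by (rule pancyclic_if_coords, rule coords.cycles_if_two_rows
        [OF row_nonzero[OF one_closed one_notin] coords.recip_one row_nonzero[OF minus_one(1,2)]
          minus_one(3) ne K3 nbr_refl[OF inv] hE])
qed

lemma pancyclic_if_involutory_even:
  assumes d: "d \<in> M - J" "d \<noteq> g"
    and inv: "\<And>N y. N \<in> max_ideals \<Longrightarrow> y \<in> carrier R \<Longrightarrow> y \<in> N \<or> \<one> \<ominus> y \<otimes> y \<in> N"
    and two: "\<And>N. N \<in> max_ideals \<Longrightarrow> \<one> \<oplus> \<one> \<in> N"
  shows "pancyclic (with_proj (jacobson_graph R))"
proof -
  have res: "y \<in> N \<or> \<one> \<ominus> y \<in> N" if N: "N \<in> max_ideals" and y: "y \<in> carrier R" for N y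
  proof -
    have "\<one> \<ominus> y \<otimes> y = (\<one> \<ominus> y) \<otimes> (\<one> \<oplus> y)" using y by algebra
    then consider "y \<in> N" | "\<one> \<ominus> y \<in> N" | "\<one> \<oplus> y \<in> N"
      using inv[OF N y] max_ideal_dest[OF N, of "\<one> \<ominus> y" "\<one> \<oplus> y"] y by auto
    then show ?thesis
    proof cases
      case 3
      have "\<one> \<ominus> y = (\<one> \<oplus> y) \<ominus> y \<otimes> (\<one> \<oplus> \<one>)" using y by algebra
      then show ?thesis
        using 3 two[OF N] y max_ideal_minus[OF N] max_ideal_mult(2)[OF N] by simp
    qed auto
  qed
  \<comment> \<open>With all maximal ideals but \<open>M\<close> for \<open>F\<close>, the only
    remaining condition is membership in \<open>M\<close>, so the path runs through
    \<open>M - J\<close>.\<close>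
  obtain p where p: "distinct p" "successively joined p"
      "set p = {x \<in> carrier R. x \<notin> J \<and> (\<forall>N \<in> max_ideals - (max_ideals - {M}). x \<in> N)}"
    using hamiltonian_path_if_residue_fields_Z2[OF res, of "max_ideals - {M}"] finite_max_ideals by auto
  have setp: "set p = M - J" unfolding p(3) using M M_subset by auto
  have "successively nbr p"
    by (rule successively_mono[OF p(2)]) (use setp in \<open>auto simp: nbr_def\<close>)
  moreover have "2 \<le> length p"
  proof -
    have "card {d, g} \<le> card (set p)" using setp d g_in finite_M' by (intro card_mono) auto
    then show ?thesis using d(2) distinct_card[OF p(1)] by simp
  qed
  moreover have "K = {row \<zero>, row \<one>}"
  proof
    show "{row \<zero>, row \<one>} \<subseteq> K" using row_in_K by simp
    show "K \<subseteq> {row \<zero>, row \<one>}"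
    proof
      fix y assume y: "y \<in> K"
      have yc: "y \<in> carrier R" "row y = y" using y K_carrier row_K by auto
      consider "y \<in> M" | "\<one> \<ominus> y \<in> M" using res[OF M yc(1)] by blast
      then show "y \<in> {row \<zero>, row \<one>}"
        using K_nonzero_iff[OF y] row_eq_iff[of \<one> y] yc by cases auto
    qed
  qed
  ultimately show ?thesis
    using setp p(1) nbr_refl[OF inv] by (intro pancyclic_if_coords coords.cycles_if_one_row[where p = p]) auto
qed

end

section \<open>Case distinction on the residue fields\<close>

theorem theorem2p2:
  fixes R :: "('a, 'm) ring_scheme"
  assumes "cring R" and "finite (carrier R)" and "\<one>\<^bsub>R\<^esub> \<noteq> \<zero>\<^bsub>R\<^esub>"
    and "\<not> local_ring R"
    and "\<And>F :: 'a ring. field F \<Longrightarrow> \<not> R \<simeq> RDirProd (ZFact 2) F"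
  shows "pancyclic (with_proj (jacobson_graph R))"
proof -
  interpret cring R by fact
  interpret finite_cring R by unfold_locales fact
  obtain M0 where M0: "M0 \<in> max_ideals" using ex_max_ideal assms(3) by blast
  have other: "\<exists>N \<in> max_ideals. N \<noteq> M" if "M \<in> max_ideals" for M
    using assms(4) that unfolding local_ring_def max_ideals_def by blast
  have chosen: "chosen_max_ideal R M" if "M \<in> max_ideals" for M
    by unfold_locales (use that other in auto)
  have d: "\<exists>d \<in> M - jacobson_radical R. d \<noteq> chosen_max_ideal.g R M" if M: "M \<in> max_ideals" for M
  proof (rule ccontr)
    interpret chosen_max_ideal R M using chosen[OF M] .
    assume "\<not> ?thesis"
    then have "R \<simeq> RDirProd (ZFact 2) (R Quot M)" by (intro iso_Z2_times_field) blast
    moreover have "field (R Quot M)"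
      using maximalideal.quotient_is_field[OF max_ideal_maximal[OF M] is_cring] .
    \<comment> \<open>The elements of \<open>R Quot M\<close> are sets of elements of
      \<open>R\<close>, whereas the assumption speaks of fields over the element type; the field is
      first copied to that type.\<close>
    ultimately show False
      using Z2_times_field_element_type[OF ring_axioms] assms(5) by blast
  qed
  show ?thesis
  \<comment> \<open>The condition says that some residue field has more than three elements:
    otherwise every non-zero residue squares to 1.\<close>
  proof (cases "\<exists>M \<in> max_ideals. \<exists>y \<in> carrier R. y \<notin> M \<and> \<one>\<^bsub>R\<^esub> \<ominus>\<^bsub>R\<^esub> y \<otimes>\<^bsub>R\<^esub> y \<notin> M")
    case True
    then obtain M y where max: "M \<in> max_ideals"
      and y: "y \<in> carrier R" "y \<notin> M" "\<one>\<^bsub>R\<^esub> \<ominus>\<^bsub>R\<^esub> y \<otimes>\<^bsub>R\<^esub> y \<notin> M" by blast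
    interpret chosen_max_ideal R M using chosen[OF max] .
    obtain d where "d \<in> M - J" "d \<noteq> g" using d[OF max] by blast
    then show ?thesis using pancyclic_if_not_involutory y by simp
  next
    case False
    then have inv: "\<And>N y. N \<in> max_ideals \<Longrightarrow> y \<in> carrier R \<Longrightarrow> y \<in> N \<or> \<one>\<^bsub>R\<^esub> \<ominus>\<^bsub>R\<^esub> y \<otimes>\<^bsub>R\<^esub> y \<in> N"
      by blast
    show ?thesis
    \<comment> \<open>Among residue fields with two or three elements, those with three are the ones
      in which 2 is not zero.\<close>
    proof (cases "\<exists>M \<in> max_ideals. \<one>\<^bsub>R\<^esub> \<oplus>\<^bsub>R\<^esub> \<one>\<^bsub>R\<^esub> \<notin> M")
      case True
      then obtain M where max: "M \<in> max_ideals" "\<one>\<^bsub>R\<^esub> \<oplus>\<^bsub>R\<^esub> \<one>\<^bsub>R\<^esub> \<notin> M" by blast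
      interpret chosen_max_ideal R M using chosen[OF max(1)] .
      obtain d where "d \<in> M - J" "d \<noteq> g" using d[OF max(1)] by blast
      then show ?thesis using pancyclic_if_involutory_odd[OF _ _ inv max(2)] by simp
    next
      case False
      interpret chosen_max_ideal R M0 using chosen[OF M0] .
      obtain d where d: "d \<in> M0 - J" "d \<noteq> g" using d[OF M0] by blast
      have "\<And>N. N \<in> max_ideals \<Longrightarrow> \<one>\<^bsub>R\<^esub> \<oplus>\<^bsub>R\<^esub> \<one>\<^bsub>R\<^esub> \<in> N" using False by simp
      then show ?thesis using pancyclic_if_involutory_even[OF d inv] by simp
    qed
  qed
qed

end
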